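(* Let $N\le 4$ ($N\ge1$ an integer). An FT$N$S system is FT$N$S symmetric hyperbolic (i.e. it admits a positive definite FT$N$S candidate symmetrizer) if and only if it is first order symmetric hyperbolic (i.e. it has a direct first order reduction admitting a positive definite first order candidate symmetrizer).
   Context: Space is $\mathbb{R}^3$ with coordinates $x^i$, $i=1,2,3$, and Euclidean metric; repeated spatial indices are summed; $(\dots)$ around indices denotes symmetrization with total weight one. All coefficient matrices are constant and complex. Underlined indices $\underline{i}$ stand for the appropriate number of spatial indices. **FT$N$S systems.** The unknowns are vectors of fields $v^0,\dots,v^{N-1}$, $v^\mu$ having $n_\mu$ components, depending on $t$ and $x$. The equations are, for $\mu=0,\dots,N-1$, $$\partial_t v^\mu=\sum_{\nu=0}^{\min(\mu+1,N-1)}(A^\mu{}_\nu)^{i_1\dots i_{\mu-\nu+1}}\partial_{i_1}\cdots\partial_{i_{\mu-\nu+1}}v^\nu+\sum_{\nu=0}^{\mu}\sum_{\rho=1}^{\mu-\nu+1}(B^\mu{}_{\rho\,\nu})^{i_1\dots i_{\mu-\nu-\rho+1}}\partial_{i_1}\cdots\partial_{i_{\mu-\nu-\rho+1}}v^\nu+s^\mu$$ (with zero indices the terms are multiplication by a matrix), with given source terms $s^\mu$ independent of the fields. **Principal matrix.** $\mathcal A_N{}^p{}_{\underline i}{}^{\underline j}$ is the block matrix with blocks $\mu,\nu=0,\dots,N-1$, where the $(\mu,\nu)$ block carries lower indices $i_1\dots i_{N-\mu-1}$ and upper indices $p\,j_1\dots j_{N-\nu-1}$ and equals $(\Delta^N_{\mu\nu})^{p(\underline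 j)}_{(\underline i)\underline k}(A^\mu{}_\nu)^{\underline k}$ for $\nu\le\mu+1$ and $0$ for $\nu>\mu+1$. Here, writing the $N-\nu$ upper indices $(p,j_1,\dots,j_{N-\nu-1})$ as $(l_1,\dots,l_{N-\nu})$, $\Delta^N_{\mu\nu}=\delta^{l_1}_{i_1}\cdots\delta^{l_{N-\mu-1}}_{i_{N-\mu-1}}\delta^{l_{N-\mu}}_{k_1}\cdots\delta^{l_{N-\nu}}_{k_{\mu-\nu+1}}$ (with the $\delta_i$ factors absent if $\mu=N-1$ and the $\delta_k$ factors absent if $\nu=\mu+1$). **FT$N$S symmetrizers.** For a vector $s\in\mathbb{R}^3$ let $S^N_{\underline j}=\mathrm{diag}(s_{j_1}\cdots s_{j_{N-1}},\,s_{j_1}\cdots s_{j_{N-2}},\dots,s_{j_1},1)$, block $\mu$ carrying $N-\mu-1$ indices. An FT$N$S candidate symmetrizer is a Hermitian matrix $H_N^{\underline i\,\underline j}=H_N^{(\underline i)\,(\underline j)}$, that is, a Hermitian form on the space of tuples $(w^\mu_{i_1\dots i_{N-\mu-1}})_{\mu=0}^{N-1}$ with $w^\mu$ a $\mathbb{C}^{n_\mu}$-valued totally symmetric tensor, such that the matrix $S^N_{\underline i}H_N^{\underline i\,\underline k}\mathcal A_N{}^p{}_{\underline k}{}^{\underline j}s_pS^N_{\underline j}$ (acting on $\mathbb{C}^{n_0}\oplus\dots\oplus\mathbb{C}^{n_{N-1}}$) is Hermitian for every $s$. The system is FT$N$S symmetric hyperbolic if there is an FT$N$S candidate symmetrizer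 that is positive definite on this space of symmetric tensors. **Direct first order reductions.** For $\mu=0,\dots,N-2$ and $\nu=1,\dots,N-\mu-1$ introduce variables $(d^\mu_\nu)_{i_1\dots i_\nu}$, $\mathbb{C}^{n_\mu}$-valued and totally symmetric in the indices, replacing $\partial_{i_1}\cdots\partial_{i_\nu}v^\mu$. Write $d^\mu_0:=v^\mu$ for all $\mu$, $d^\mu:=d^\mu_{N-\mu-1}$ for $\mu\le N-2$ and $d^{N-1}:=v^{N-1}$. The auxiliary constraints are, for $\nu=0,\dots,N-2$, $\sigma=1,\dots,N-\nu-1$, $$(c^\nu_\sigma)_{i_1\dots i_\sigma}=\partial_{(i_1}(d^\nu_{\sigma-1})_{i_2\dots i_\sigma)}-(d^\nu_\sigma)_{i_1\dots i_\sigma},\qquad(\bar c^\nu_\sigma)_{i_1\dots i_{\sigma+1}}=\partial_{i_1}(d^\nu_\sigma)_{i_2\dots i_{\sigma+1}}-\partial_{(i_1}(d^\nu_\sigma)_{i_2\dots i_{\sigma+1})}.$$ To each evolution equation, labelled by $X$ (either $X=\mu$ for $v^\mu$, or $X=(\mu,\lambda,i_1,\dots,i_\lambda)$ for $(d^\mu_\lambda)_{i_1\dots i_\lambda}$), one adds $$C^X=\sum_{\nu=0}^{N-2}\sum_{\sigma=1}^{N-\nu-1}\Big[(D^{X\,\sigma}{}_\nu)^{i_1\dots i_\sigma}(c^\nu_\sigma)_{i_1\dots i_\sigma}+(\bar D^{X\,\sigma}{}_\nu)^{i_1\dots i_{\sigma+1}}(\bar c^\nu_\sigma)_{i_1\dots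 i_{\sigma+1}}\Big],$$ with arbitrary constant matrices $D,\bar D$ (the reduction parameters), independent for different equations (symmetric in $i_1\dots i_\lambda$ of $X$), subject to: $D^{X\,\sigma}{}_\nu$ is totally symmetric in its upper indices, $(\bar D^{X\,\sigma}{}_\nu)^{(i_1\dots i_{\sigma+1})}=0$, and $(\bar D^{X\,\sigma}{}_\nu)^{i_1i_2\dots i_{\sigma+1}}=(\bar D^{X\,\sigma}{}_\nu)^{i_1(i_2\dots i_{\sigma+1})}$. A first order reduction is a system of the following form. For $0\le\mu\le N-2$, $0\le\sigma\le N-\mu-2$ (with $\sigma=0$ giving the equation for $v^\mu$): $$\partial_t(d^\mu_\sigma)_{\underline i}=\sum_{\nu=0}^{\mu+1}(A^\mu{}_\nu)^{\underline j}(d^\nu_{\mu+\sigma-\nu+1})_{\underline i\,\underline j}+\sum_{\nu=0}^{\mu}\sum_{\rho=1}^{\mu-\nu+1}(B^\mu{}_{\rho\,\nu})^{\underline j}(d^\nu_{\mu+\sigma-\nu-\rho+1})_{\underline i\,\underline j}+\partial_{i_1}\cdots\partial_{i_\sigma}s^\mu+C^X.$$ For $0\le\mu\le N-2$, with $\underline i=i_1\dots i_{N-\mu-1}$ and total symmetrization over all indices of $\partial$ and $d^\nu$: $$\partial_t(d^\mu)_{\underline i}=\sum_{\nu=0}^{\mu+1}(A^\mu{}_\nu)^{\underline j}\,\partial_{(i_1}(d^\nu)_{i_2\dots i_{N-\mu-1}\underline j)}+\sum_{\nu=0}^{\mu}\sum_{\rho=1}^{\mu-\nu+1}(B^\mu{}_{\rho\,\nu})^{\underline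 j}(d^\nu_{N-\nu-\rho})_{\underline i\,\underline j}+\partial_{i_1}\cdots\partial_{i_{N-\mu-1}}s^\mu+C^X.$$ Finally $$\partial_tv^{N-1}=\sum_{\nu=0}^{N-1}(A^{N-1}{}_\nu)^{j\underline i}\partial_j(d^\nu)_{\underline i}+\sum_{\nu=0}^{N-1}\sum_{\rho=1}^{N-\nu}(B^{N-1}{}_{\rho\,\nu})^{\underline j}(d^\nu_{N-\nu-\rho})_{\underline j}+s^{N-1}+C^{N-1}.$$ (For $N=1$ there are no new variables or constraints and the only reduction is the system itself.) With $u$ the vector of all variables $d^\mu_\nu$ ($0\le\mu\le N-1$, $0\le\nu\le N-\mu-1$), keeping only the terms with first derivatives of the variables gives the principal part $\partial_tu_{\underline i}\simeq\mathcal A_1{}^p{}_{\underline i}{}^{\underline j}\partial_pu_{\underline j}$, which defines $\mathcal A_1{}^p$ as linear maps on the space of values of $u$ (tuples of totally symmetric tensors). **First order symmetrizers.** A Hermitian matrix $H_1^{\underline i\,\underline j}=H_1^{(\underline i)\,(\underline j)}$ (a Hermitian form on the space of values of $u$) is a first order candidate symmetrizer of the FT$N$S system if there is a first order reduction (choice of $D,\bar D$) such that $H_1^{\underline i\,\underline k}\mathcal A_1{}^p{}_{\underline k}{}^{\underline j}s_p$ is Hermitian for every $s\in\mathbb{R}^3$. The system is first order symmetric hyperbolic if there is a first order candidate symmetrizer that is positive definite on the space of symmetric tensors. *)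

theory Defs
  imports "HOL-Analysis.Analysis" "HOL-Combinatorics.Permutations"
begin

section \<open>Tensors\<close>

text \<open>A tensor of rank \<open>r\<close> over three-dimensional space is a function on index lists of
  length \<open>r\<close>; only its values on such lists matter.\<close>

definition tuples :: "nat \<Rightarrow> 3 list set" where
  "tuples r = {ii. length ii = r}"

definition symmetrize :: "(3 list \<Rightarrow> complex) \<Rightarrow> 3 list \<Rightarrow> complex" where
  "symmetrize T ii =
     (\<Sum>\<pi> | \<pi> permutes {..<length ii}. T (permute_list \<pi> ii)) / fact (length ii)"

definition symmetric_tensor :: "nat \<Rightarrow> (3 list \<Rightarrow> complex) \<Rightarrow> bool" where
  "symmetric_tensor r T \<longleftrightarrow>
     (\<forall>ii\<in>tuples r. \<forall>\<pi>. \<pi> permutes {..<r} \<longrightarrow> T (permute_list \<pi> ii) = T ii)"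

text \<open>\<open>(\<mu>, ii, a)\<close> labels the component \<open>a\<close> (counted from 0) of the entry \<open>ii\<close> of a tensor
  belonging to \<open>v\<^sup>\<mu>\<close>. The rank of the tensor is the length of \<open>ii\<close>, so that \<open>(\<mu>, ii, a)\<close> also
  labels the component \<open>a\<close> of the entry \<open>ii\<close> of the reduction variable \<open>d\<^sup>\<mu>\<close> with lower
  label \<open>length ii\<close>, and \<open>(\<mu>, [], a)\<close> a component of \<open>v\<^sup>\<mu>\<close> itself.\<close>

type_synonym idx = "nat \<times> 3 list \<times> nat"
type_synonym state = "idx \<Rightarrow> complex"

definition symmetric_on :: "idx set \<Rightarrow> state \<Rightarrow> bool" where
  "symmetric_on X u \<longleftrightarrow> (\<forall>(\<mu>, ii, a)\<in>X. symmetric_tensor (length ii) (\<lambda>jj. u (\<mu>, jj, a)))"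

definition states :: "idx set \<Rightarrow> state set" where
  "states X = {u. symmetric_on X u \<and> (\<forall>I. I \<notin> X \<longrightarrow> u I = 0)}"

section \<open>Hermitian matrices and forms\<close>

definition hermitian_on :: "'i set \<Rightarrow> ('i \<Rightarrow> 'i \<Rightarrow> complex) \<Rightarrow> bool" where
  "hermitian_on X M \<longleftrightarrow> (\<forall>I\<in>X. \<forall>J\<in>X. M I J = cnj (M J I))"

definition symmetric_hermitian :: "idx set \<Rightarrow> (idx \<Rightarrow> idx \<Rightarrow> complex) \<Rightarrow> bool" where
  "symmetric_hermitian X H \<longleftrightarrow> hermitian_on X H \<and>
     (\<forall>J\<in>X. symmetric_on X (\<lambda>I. H I J)) \<and> (\<forall>I\<in>X. symmetric_on X (\<lambda>J. H I J))"

definition sesq :: "idx set \<Rightarrow> (idx \<Rightarrow> idx \<Rightarrow> complex) \<Rightarrow> state \<Rightarrow> state \<Rightarrow> complex" where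
  "sesq X H u w = (\<Sum>I\<in>X. \<Sum>J\<in>X. cnj (u I) * H I J * w J)"

definition positive_definite_on :: "idx set \<Rightarrow> (idx \<Rightarrow> idx \<Rightarrow> complex) \<Rightarrow> bool" where
  "positive_definite_on X H \<longleftrightarrow> (\<forall>u\<in>states X. u \<noteq> (\<lambda>_. 0) \<longrightarrow> 0 < Re (sesq X H u u))"

section \<open>FTNS systems\<close>

text \<open>\<open>coefA sys \<mu> \<nu> kk a b\<close> is the entry in row \<open>a\<close> and column \<open>b\<close> of the coefficient matrix
  of \<open>\<partial>\<^bsub>kk\<^esub> v\<^sup>\<nu>\<close> in the equation for \<open>v\<^sup>\<mu>\<close>, for \<open>kk\<close> of length \<open>\<mu> - \<nu> + 1\<close>; likewise
  \<open>coefB sys \<mu> \<rho> \<nu> kk a b\<close>, for \<open>kk\<close> of length \<open>\<mu> - \<nu> - \<rho> + 1\<close>. No symmetry in \<open>kk\<close> is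
  assumed.\<close>

record ftns_system =
  sys_order :: nat
  ncomp :: "nat \<Rightarrow> nat"
  coefA :: "nat \<Rightarrow> nat \<Rightarrow> 3 list \<Rightarrow> nat \<Rightarrow> nat \<Rightarrow> complex"
  coefB :: "nat \<Rightarrow> nat \<Rightarrow> nat \<Rightarrow> 3 list \<Rightarrow> nat \<Rightarrow> nat \<Rightarrow> complex"
  source :: "nat \<Rightarrow> real \<Rightarrow> real^3 \<Rightarrow> nat \<Rightarrow> complex"

definition partial :: "3 \<Rightarrow> (real^3 \<Rightarrow> complex) \<Rightarrow> real^3 \<Rightarrow> complex" where
  "partial i f x = vector_derivative (\<lambda>h. f (x + h *\<^sub>R axis i 1)) (at 0)"

definition partials :: "3 list \<Rightarrow> (real^3 \<Rightarrow> complex) \<Rightarrow> real^3 \<Rightarrow> complex" where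
  "partials ii f = foldr partial ii f"

text \<open>Fields and sources are understood to be smooth wherever they are differentiated.\<close>

definition ftns_rhs ::
  "ftns_system \<Rightarrow> (nat \<Rightarrow> real \<Rightarrow> real^3 \<Rightarrow> nat \<Rightarrow> complex) \<Rightarrow> nat \<Rightarrow> real \<Rightarrow> real^3 \<Rightarrow> nat \<Rightarrow> complex"
where
  "ftns_rhs sys v \<mu> t x a =
     (\<Sum>\<nu>\<in>{0..min (\<mu> + 1) (sys_order sys - 1)}. \<Sum>kk\<in>tuples (\<mu> + 1 - \<nu>). \<Sum>b<ncomp sys \<nu>.
        coefA sys \<mu> \<nu> kk a b * partials kk (\<lambda>y. v \<nu> t y b) x) +
     (\<Sum>\<nu>\<in>{0..\<mu>}. \<Sum>\<rho>\<in>{1..\<mu> - \<nu> + 1}. \<Sum>kk\<in>tuples (\<mu> - \<nu> + 1 - \<rho>). \<Sum>b<ncomp sys \<nu>.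
        coefB sys \<mu> \<rho> \<nu> kk a b * partials kk (\<lambda>y. v \<nu> t y b) x) +
     source sys \<mu> t x a"

definition ftns_solution ::
  "ftns_system \<Rightarrow> (nat \<Rightarrow> real \<Rightarrow> real^3 \<Rightarrow> nat \<Rightarrow> complex) \<Rightarrow> bool" where
  "ftns_solution sys v \<longleftrightarrow> (\<forall>\<mu><sys_order sys. \<forall>a<ncomp sys \<mu>. \<forall>t x.
     ((\<lambda>\<tau>. v \<mu> \<tau> x a) has_vector_derivative ftns_rhs sys v \<mu> t x a) (at t))"

section \<open>FTNS symmetric hyperbolicity\<close>

definition top_idx :: "ftns_system \<Rightarrow> idx set" where
  "top_idx sys =
     {(\<mu>, ii, a). \<mu> < sys_order sys \<and> length ii = sys_order sys - \<mu> - 1 \<and> a < ncomp sys \<mu>}"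

text \<open>The product of Kronecker symbols \<open>\<Delta>\<close> is 1 precisely if the concatenation of its lower
  index lists \<open>ii\<close> and \<open>kk\<close> is its upper index list \<open>p # jj\<close>. The symmetrization is over \<open>jj\<close>
  and over \<open>ii\<close> separately and does not involve \<open>p\<close>.\<close>

definition Delta_sym :: "3 \<Rightarrow> 3 list \<Rightarrow> 3 list \<Rightarrow> 3 list \<Rightarrow> complex" where
  "Delta_sym p jj ii kk =
     symmetrize (\<lambda>jj'. symmetrize (\<lambda>ii'. of_bool (p # jj' = ii' @ kk)) ii) jj"

fun principal_N :: "ftns_system \<Rightarrow> 3 \<Rightarrow> idx \<Rightarrow> idx \<Rightarrow> complex" where
  "principal_N sys p (\<mu>, ii, a) (\<nu>, jj, b) =
     (if \<nu> \<le> \<mu> + 1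
      then \<Sum>kk\<in>tuples (\<mu> + 1 - \<nu>). Delta_sym p jj ii kk * coefA sys \<mu> \<nu> kk a b
      else 0)"

definition s_prod :: "real^3 \<Rightarrow> 3 list \<Rightarrow> complex" where
  "s_prod s ii = of_real (prod_list (map (\<lambda>i. s $ i) ii))"

fun contracted_N ::
  "ftns_system \<Rightarrow> (idx \<Rightarrow> idx \<Rightarrow> complex) \<Rightarrow> real^3 \<Rightarrow> nat \<times> nat \<Rightarrow> nat \<times> nat \<Rightarrow> complex" where
  "contracted_N sys H s (\<mu>, a) (\<nu>, b) =
     (\<Sum>ii\<in>tuples (sys_order sys - \<mu> - 1). \<Sum>K\<in>top_idx sys. \<Sum>p\<in>UNIV. \<Sum>jj\<in>tuples (sys_order sys - \<nu> - 1).
        s_prod s ii * H (\<mu>, ii, a) K * principal_N sys p K (\<nu>, jj, b) * of_real (s $ p) * s_prod s jj)"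

definition ftns_candidate_symmetrizer :: "ftns_system \<Rightarrow> (idx \<Rightarrow> idx \<Rightarrow> complex) \<Rightarrow> bool" where
  "ftns_candidate_symmetrizer sys H \<longleftrightarrow>
     symmetric_hermitian (top_idx sys) H \<and>
     (\<forall>s. hermitian_on {(\<mu>, a). \<mu> < sys_order sys \<and> a < ncomp sys \<mu>} (contracted_N sys H s))"

definition ftns_symmetric_hyperbolic :: "ftns_system \<Rightarrow> bool" where
  "ftns_symmetric_hyperbolic sys \<longleftrightarrow>
     (\<exists>H. ftns_candidate_symmetrizer sys H \<and> positive_definite_on (top_idx sys) H)"

section \<open>Direct first order reductions\<close>

definition red_idx :: "ftns_system \<Rightarrow> idx set" where
  "red_idx sys =
     {(\<mu>, ii, a). \<mu> < sys_order sys \<and> length ii \<le> sys_order sys - \<mu> - 1 \<and> a < ncomp sys \<mu>}"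

text \<open>The reduction parameters are given by \<open>Dpar r I (\<nu>, kk, b)\<close> and \<open>Dbpar r I (\<nu>, kk, b)\<close>. The label
  \<open>I = (\<mu>, ii, a)\<close> comprises the label \<open>X\<close> of the equation (its type \<open>\<mu>\<close>, and the indices \<open>ii\<close>,
  whose number is \<open>\<lambda>\<close>) and the row \<open>a\<close> of the parameter matrix, and \<open>b\<close> is the column. The
  constraint label \<open>\<sigma>\<close> is \<open>length kk\<close> for \<open>Dpar\<close> and \<open>length kk - 1\<close> for \<open>Dbpar\<close>.\<close>

record reduction_params =
  Dpar :: "idx \<Rightarrow> idx \<Rightarrow> complex"
  Dbpar :: "idx \<Rightarrow> idx \<Rightarrow> complex"

definition admissible :: "ftns_system \<Rightarrow> reduction_params \<Rightarrow> bool" where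
  "admissible sys r \<longleftrightarrow>
     (\<forall>\<nu><sys_order sys - 1. \<forall>\<sigma>\<in>{1..sys_order sys - \<nu> - 1}. \<forall>b<ncomp sys \<nu>.
        (\<forall>kk\<in>tuples \<sigma>. symmetric_on (red_idx sys) (\<lambda>I. Dpar r I (\<nu>, kk, b))) \<and>
        (\<forall>kk\<in>tuples (\<sigma> + 1). symmetric_on (red_idx sys) (\<lambda>I. Dbpar r I (\<nu>, kk, b))) \<and>
        (\<forall>I\<in>red_idx sys.
           symmetric_tensor \<sigma> (\<lambda>kk. Dpar r I (\<nu>, kk, b)) \<and>
           (\<forall>kk\<in>tuples (\<sigma> + 1). symmetrize (\<lambda>kk'. Dbpar r I (\<nu>, kk', b)) kk = 0) \<and>
           (\<forall>k. symmetric_tensor \<sigma> (\<lambda>kk. Dbpar r I (\<nu>, k # kk, b)))))"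

text \<open>Below, \<open>u\<close> stands for the values of the reduction variables and \<open>du p\<close> for those of their
  derivatives \<open>\<partial>\<^sub>p\<close> at a point. \<open>grad du \<nu> b (i # ii)\<close> is the derivative \<open>\<partial>\<^sub>i\<close> of the entry \<open>ii\<close>.\<close>

definition grad :: "(3 \<Rightarrow> state) \<Rightarrow> nat \<Rightarrow> nat \<Rightarrow> 3 list \<Rightarrow> complex" where
  "grad du \<nu> b ii = du (hd ii) (\<nu>, tl ii, b)"

definition constr :: "state \<Rightarrow> (3 \<Rightarrow> state) \<Rightarrow> nat \<Rightarrow> 3 list \<Rightarrow> nat \<Rightarrow> complex" where
  "constr u du \<nu> ii b = symmetrize (grad du \<nu> b) ii - u (\<nu>, ii, b)"

definition constr_bar :: "(3 \<Rightarrow> state) \<Rightarrow> nat \<Rightarrow> 3 list \<Rightarrow> nat \<Rightarrow> complex" where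
  "constr_bar du \<nu> ii b = grad du \<nu> b ii - symmetrize (grad du \<nu> b) ii"

definition constraint_addition ::
  "ftns_system \<Rightarrow> reduction_params \<Rightarrow> state \<Rightarrow> (3 \<Rightarrow> state) \<Rightarrow> idx \<Rightarrow> complex" where
  "constraint_addition sys r u du I =
     (\<Sum>\<nu><sys_order sys - 1. \<Sum>\<sigma>\<in>{1..sys_order sys - \<nu> - 1}.
        (\<Sum>kk\<in>tuples \<sigma>. \<Sum>b<ncomp sys \<nu>. Dpar r I (\<nu>, kk, b) * constr u du \<nu> kk b) +
        (\<Sum>kk\<in>tuples (\<sigma> + 1). \<Sum>b<ncomp sys \<nu>. Dbpar r I (\<nu>, kk, b) * constr_bar du \<nu> kk b))"

text \<open>The terms with the coefficients \<open>A\<close>: the three cases are the equations for the lower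
  \<open>d\<^sup>\<mu>\<close> (including \<open>v\<^sup>\<mu>\<close>), for the highest \<open>d\<^sup>\<mu>\<close>, and for \<open>v\<^bsup>N-1\<^esup>\<close>.\<close>

fun A_terms :: "ftns_system \<Rightarrow> state \<Rightarrow> (3 \<Rightarrow> state) \<Rightarrow> idx \<Rightarrow> complex" where
  "A_terms sys u du (\<mu>, ii, a) =
     (if \<mu> + length ii + 2 \<le> sys_order sys then
        \<Sum>\<nu>\<in>{0..\<mu> + 1}. \<Sum>jj\<in>tuples (\<mu> + 1 - \<nu>). \<Sum>b<ncomp sys \<nu>.
          coefA sys \<mu> \<nu> jj a b * u (\<nu>, ii @ jj, b)
      else if \<mu> + 2 \<le> sys_order sys then
        \<Sum>\<nu>\<in>{0..\<mu> + 1}. \<Sum>jj\<in>tuples (\<mu> + 1 - \<nu>). \<Sum>b<ncomp sys \<nu>.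
          coefA sys \<mu> \<nu> jj a b * symmetrize (grad du \<nu> b) (ii @ jj)
      else
        \<Sum>\<nu>\<in>{0..\<mu>}. \<Sum>j\<in>UNIV. \<Sum>jj\<in>tuples (\<mu> - \<nu>). \<Sum>b<ncomp sys \<nu>.
          coefA sys \<mu> \<nu> (j # jj) a b * du j (\<nu>, jj, b))"

fun B_terms :: "ftns_system \<Rightarrow> state \<Rightarrow> idx \<Rightarrow> complex" where
  "B_terms sys u (\<mu>, ii, a) =
     (\<Sum>\<nu>\<in>{0..\<mu>}. \<Sum>\<rho>\<in>{1..\<mu> - \<nu> + 1}. \<Sum>jj\<in>tuples (\<mu> - \<nu> + 1 - \<rho>). \<Sum>b<ncomp sys \<nu>.
        coefB sys \<mu> \<rho> \<nu> jj a b * u (\<nu>, ii @ jj, b))"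

text \<open>\<open>src (\<mu>, ii, a)\<close> stands for the value of \<open>\<partial>\<^bsub>ii\<^esub> s\<^sup>\<mu>\<close> (component \<open>a\<close>) at the point.\<close>

definition reduction_rhs ::
  "ftns_system \<Rightarrow> reduction_params \<Rightarrow> state \<Rightarrow> state \<Rightarrow> (3 \<Rightarrow> state) \<Rightarrow> idx \<Rightarrow> complex" where
  "reduction_rhs sys r src u du I =
     A_terms sys u du I + B_terms sys u I + src I + constraint_addition sys r u du I"

definition reduction_solution ::
  "ftns_system \<Rightarrow> reduction_params \<Rightarrow> (real \<Rightarrow> real^3 \<Rightarrow> state) \<Rightarrow> bool" where
  "reduction_solution sys r u \<longleftrightarrow>
     (\<forall>t x. u t x \<in> states (red_idx sys)) \<and>
     (\<forall>I\<in>red_idx sys. \<forall>t x. ((\<lambda>\<tau>. u \<tau> x I) has_vector_derivative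
        reduction_rhs sys r (\<lambda>(\<mu>, ii, a). partials ii (\<lambda>y. source sys \<mu> t y a) x)
          (u t x) (\<lambda>p J. partial p (\<lambda>y. u t y J) x) I) (at t))"

text \<open>The right-hand side is affine in \<open>(src, u, du)\<close>. Keeping only the terms with first
  derivatives amounts to setting \<open>src = 0\<close> and \<open>u = 0\<close>, and the coefficient of \<open>\<partial>\<^sub>p u\<close> is obtained
  by letting only \<open>du p\<close> be nonzero.\<close>

definition principal_1 :: "ftns_system \<Rightarrow> reduction_params \<Rightarrow> 3 \<Rightarrow> state \<Rightarrow> state" where
  "principal_1 sys r p w =
     (\<lambda>I. if I \<in> red_idx sys
          then reduction_rhs sys r (\<lambda>_. 0) (\<lambda>_. 0) (\<lambda>q. if q = p then w else (\<lambda>_. 0)) I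
          else 0)"

section \<open>First order symmetric hyperbolicity\<close>

definition symbol_1 :: "ftns_system \<Rightarrow> reduction_params \<Rightarrow> real^3 \<Rightarrow> state \<Rightarrow> state" where
  "symbol_1 sys r s w = (\<lambda>I. \<Sum>p\<in>UNIV. of_real (s $ p) * principal_1 sys r p w I)"

definition first_order_candidate_symmetrizer ::
  "ftns_system \<Rightarrow> (idx \<Rightarrow> idx \<Rightarrow> complex) \<Rightarrow> bool" where
  "first_order_candidate_symmetrizer sys H \<longleftrightarrow>
     symmetric_hermitian (red_idx sys) H \<and>
     (\<exists>r. admissible sys r \<and>
        (\<forall>s. \<forall>u\<in>states (red_idx sys). \<forall>w\<in>states (red_idx sys).
           sesq (red_idx sys) H u (symbol_1 sys r s w) =
           cnj (sesq (red_idx sys) H w (symbol_1 sys r s u))))"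

definition first_order_symmetric_hyperbolic :: "ftns_system \<Rightarrow> bool" where
  "first_order_symmetric_hyperbolic sys \<longleftrightarrow>
     (\<exists>H. first_order_candidate_symmetrizer sys H \<and> positive_definite_on (red_idx sys) H)"

end

theory Submission imports Defs begin

text \<open>If the reduction variables are those of a plane wave, \<open>w = s \<otimes> \<dots> \<otimes> s \<otimes> v\<close> in the top-rank slots, the
  mixed-symmetry parts of \<open>s \<otimes> w\<close> vanish, so no constraint addition contributes and the first order
  symbol reduces to the FTNS one. Hence a first order symmetrizer, restricted to the top-rank
  variables, is an FTNS symmetrizer.

  Conversely, extend an FTNS symmetrizer \<open>H\<close> by the identity on the lower-rank variables, whose
  equations are given no principal part. Since \<open>H\<close> is invertible, the reduction parameters then
  change exactly the mixed-symmetry part of \<open>H A\<^sup>p\<close> in \<open>V\<^sub>m \<otimes> V\<^sub>1 \<otimes> V\<^sub>n\<close>, where \<open>V\<^sub>k\<close> are the symmetric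
  tensors of rank \<open>k\<close>. One needs a tensor whose symmetrization over the last \<open>1 + n\<close> indices is that
  of \<open>H A\<^sup>p\<close> and whose symmetrization over the first \<open>m + 1\<close> indices is that of the adjoint. By the
  Fredholm alternative the only obstruction comes from tensors that are symmetric in both index
  groups. The groups share an index, so these are totally symmetric, and the obstruction is the
  difference of the totally symmetric parts, which vanishes by the defining property of FTNS
  symmetrizers.\<close>

section \<open>Averages over classes\<close>

text \<open>With \<open>c = mset\<close> on index lists of one rank this is symmetrization, and with
  \<open>c = idx_class\<close> it projects onto the functions constant on classes of labels. Both
  uses share the lemmas below.\<close>

definition class_avg :: "'i set \<Rightarrow> ('i \<Rightarrow> 'c) \<Rightarrow> ('i \<Rightarrow> complex) \<Rightarrow> 'i \<Rightarrow> complex" where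
  "class_avg X c f x = (\<Sum>y | y \<in> X \<and> c y = c x. f y) / of_nat (card {y\<in>X. c y = c x})"

lemma class_avg_cong_class: "c x = c y \<Longrightarrow> class_avg X c f x = class_avg X c f y"
  by (simp add: class_avg_def)

lemma class_avg_invariant:
  assumes "finite X" "x \<in> X" "\<And>y. y \<in> X \<Longrightarrow> c y = c x \<Longrightarrow> f y = f x"
  shows "class_avg X c f x = f x"
proof -
  have "card {y\<in>X. c y = c x} \<noteq> 0"
    using assms(1,2) by auto
  moreover have "(\<Sum>y | y \<in> X \<and> c y = c x. f y) = of_nat (card {y\<in>X. c y = c x}) * f x"
    using assms(3) by simp
  ultimately show ?thesis
    by (simp add: class_avg_def)
qed

text \<open>Both sides equal the sum, over all pairs in a common class, of \<open>f y * g x\<close>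
  divided by the class size, which may be read at either member of the pair. Averaging is thus
  self-adjoint.\<close>

lemma sum_class_avg:
  assumes "finite X"
  shows "(\<Sum>x\<in>X. class_avg X c f x * g x) = (\<Sum>x\<in>X. f x * class_avg X c g x)"
proof -
  let ?n = "\<lambda>x. complex_of_nat (card {y\<in>X. c y = c x})"
  have "(\<Sum>x\<in>X. class_avg X c f x * g x) = (\<Sum>x\<in>X. \<Sum>y\<in>X. if c y = c x then f y * g x / ?n x else 0)"
    using assms by (simp add: class_avg_def sum.inter_filter sum_divide_distrib sum_distrib_right
        if_distrib[of "\<lambda>a. a * _"] if_distrib[of "\<lambda>a. a / _"] cong: if_cong)
  also have "\<dots> = (\<Sum>y\<in>X. \<Sum>x\<in>X. if c x = c y then f y * g x / ?n y else 0)"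
    by (subst sum.swap) (intro sum.cong refl, auto)
  also have "\<dots> = (\<Sum>x\<in>X. f x * class_avg X c g x)"
    using assms by (simp add: class_avg_def sum.inter_filter sum_divide_distrib sum_distrib_left
        if_distrib[of "\<lambda>a. _ * a"] if_distrib[of "\<lambda>a. a / _"] cong: if_cong)
  finally show ?thesis .
qed

section \<open>Symmetrization as an average over rearrangements\<close>

lemma finite_tuples [simp]: "finite (tuples r)"
  using finite_lists_length_eq[of "UNIV :: 3 set" r] by (simp add: tuples_def)

lemma symmetrize_cong:
  assumes "\<And>ys. mset ys = mset xs \<Longrightarrow> f ys = g ys"
  shows "symmetrize f xs = symmetrize g xs"
  unfolding symmetrize_def by (intro arg_cong2[where f="(/)"] sum.cong refl assms) auto

lemma symmetrize_permute_list:
  assumes "\<sigma> permutes {..<length xs}"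
  shows "symmetrize f (permute_list \<sigma> xs) = symmetrize f xs"
proof -
  have "(\<Sum>\<pi> | \<pi> permutes {..<length xs}. f (permute_list \<pi> (permute_list \<sigma> xs)))
      = (\<Sum>\<pi> | \<pi> permutes {..<length xs}. f (permute_list (\<sigma> \<circ> \<pi>) xs))"
    by (intro sum.cong refl) (simp add: permute_list_compose)
  also have "\<dots> = (\<Sum>\<pi> | \<pi> permutes {..<length xs}. f (permute_list \<pi> xs))"
    using setum_permutations_compose_left[OF assms, of "\<lambda>\<pi>. f (permute_list \<pi> xs)"]
    by (simp add: o_def)
  finally show ?thesis
    by (simp add: symmetrize_def)
qed

lemma symmetrize_cong_mset: "mset xs = mset ys \<Longrightarrow> symmetrize f xs = symmetrize f ys"
  by (metis mset_eq_permutation symmetrize_permute_list)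

lemma bij_betw_permute_list_class:
  assumes "\<pi> permutes {..<n}"
  shows "bij_betw (permute_list \<pi>) {ys\<in>tuples n. mset ys = M} {ys\<in>tuples n. mset ys = M}"
proof (rule bij_betw_byWitness[where f'="permute_list (inv \<pi>)"])
  have i: "inv \<pi> permutes {..<n}"
    using assms by (rule permutes_inv)
  show "\<forall>ys\<in>{ys\<in>tuples n. mset ys = M}. permute_list (inv \<pi>) (permute_list \<pi> ys) = ys"
    using i by (auto simp: tuples_def permute_list_compose[symmetric] permutes_inv_o[OF assms])
  show "\<forall>ys\<in>{ys\<in>tuples n. mset ys = M}. permute_list \<pi> (permute_list (inv \<pi>) ys) = ys"
    using assms by (auto simp: tuples_def permute_list_compose[symmetric] permutes_inv_o[OF assms])
qed (use assms permutes_inv[OF assms] in \<open>auto simp: tuples_def\<close>)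

text \<open>Double counting: \<open>symmetrize f\<close> is constant on the rearrangements of
  \<open>xs\<close>, and each permutation of positions maps this set bijectively to itself. Summing
  over the set turns the average over permutations into one over distinct lists.\<close>

lemma symmetrize_eq_class_avg:
  "symmetrize f xs = class_avg (tuples (length xs)) mset f xs"
proof -
  let ?n = "length xs"
  let ?C = "{ys\<in>tuples ?n. mset ys = mset xs}"
  let ?P = "{\<pi>. \<pi> permutes {..<?n}}"
  have "xs \<in> ?C" by (simp add: tuples_def)
  then have c0: "card ?C \<noteq> 0"
    using card_eq_0_iff[of ?C] by auto
  have "of_nat (card ?C) * symmetrize f xs = (\<Sum>ys\<in>?C. symmetrize f ys)"
  proof -
    have "(\<Sum>ys\<in>?C. symmetrize f ys) = (\<Sum>ys\<in>?C. symmetrize f xs)"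
      by (rule sum.cong[OF refl], rule symmetrize_cong_mset) simp
    then show ?thesis by simp
  qed
  also have "\<dots> = (\<Sum>\<pi>\<in>?P. \<Sum>ys\<in>?C. f (permute_list \<pi> ys)) / fact ?n"
    by (subst sum.swap) (auto simp: symmetrize_def tuples_def sum_divide_distrib intro!: sum.cong)
  also have "\<dots> = (\<Sum>\<pi>\<in>?P. \<Sum>ys\<in>?C. f ys) / fact ?n"
  proof -
    have "(\<Sum>ys\<in>?C. f (permute_list \<pi> ys)) = (\<Sum>ys\<in>?C. f ys)" if "\<pi> \<in> ?P" for \<pi>
      by (rule sum.reindex_bij_betw[OF bij_betw_permute_list_class]) (use that in simp)
    then have "(\<Sum>\<pi>\<in>?P. \<Sum>ys\<in>?C. f (permute_list \<pi> ys)) = (\<Sum>\<pi>\<in>?P. \<Sum>ys\<in>?C. f ys)"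
      by (rule sum.cong[OF refl])
    then show ?thesis by (rule arg_cong)
  qed
  also have "\<dots> = (\<Sum>ys\<in>?C. f ys)"
    by (simp add: card_permutations[OF refl])
  finally show ?thesis
    using c0 by (simp add: class_avg_def divide_simps mult.commute)
qed

lemma symmetrize_invariant:
  assumes "\<And>ys. mset ys = mset xs \<Longrightarrow> f ys = f xs"
  shows "symmetrize f xs = f xs"
  unfolding symmetrize_eq_class_avg
proof (rule class_avg_invariant)
  show "f ys = f xs" if "mset ys = mset xs" for ys
    using that by (rule assms)
qed (rule finite_tuples, simp add: tuples_def)

lemma sum_symmetrize:
  "(\<Sum>xs\<in>tuples n. symmetrize f xs * g xs) = (\<Sum>xs\<in>tuples n. f xs * symmetrize g xs)"
proof -
  have "symmetrize h xs = class_avg (tuples n) mset h xs" if "xs \<in> tuples n" for h xs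
    using that by (simp add: symmetrize_eq_class_avg tuples_def)
  then have "(\<Sum>xs\<in>tuples n. symmetrize f xs * g xs) = (\<Sum>xs\<in>tuples n. class_avg (tuples n) mset f xs * g xs)"
    "(\<Sum>xs\<in>tuples n. f xs * symmetrize g xs) = (\<Sum>xs\<in>tuples n. f xs * class_avg (tuples n) mset g xs)"
    by (auto intro!: sum.cong)
  then show ?thesis
    by (simp only: sum_class_avg[OF finite_tuples])
qed

text \<open>Permuting positions reaches exactly the lists with the same multiset, so symmetry can be
  used without mentioning permutations.\<close>

lemma symmetric_tensor_iff:
  "symmetric_tensor r T \<longleftrightarrow> (\<forall>xs ys. length xs = r \<longrightarrow> mset xs = mset ys \<longrightarrow> T xs = T ys)"
proof (intro iffI allI impI)
  fix xs ys :: "3 list" assume a: "symmetric_tensor r T" "length xs = r" "mset xs = mset ys"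
  then obtain \<pi> where "\<pi> permutes {..<length ys}" "permute_list \<pi> ys = xs"
    using mset_eq_permutation by blast
  then show "T xs = T ys"
    using a mset_eq_length[OF a(3)] by (auto simp: symmetric_tensor_def tuples_def)
next
  assume a: "\<forall>xs ys. length xs = r \<longrightarrow> mset xs = mset ys \<longrightarrow> T xs = T ys"
  show "symmetric_tensor r T"
    unfolding symmetric_tensor_def tuples_def
  proof (intro ballI allI impI)
    fix xs :: "3 list" and \<pi> assume "xs \<in> {ii. length ii = r}" "\<pi> permutes {..<r}"
    then show "T (permute_list \<pi> xs) = T xs"
      using a[rule_format, of "permute_list \<pi> xs" xs] by simp
  qed
qed

lemma symmetrize_sum: "symmetrize (\<lambda>ys. \<Sum>i\<in>A. f i ys) xs = (\<Sum>i\<in>A. symmetrize (f i) xs)"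
  unfolding symmetrize_def by (subst sum.swap) (simp add: sum_divide_distrib)

lemma symmetrize_mult_left: "symmetrize (\<lambda>ys. c * f ys) xs = c * symmetrize f xs"
  by (simp add: symmetrize_def sum_distrib_left)

lemma symmetrize_diff: "symmetrize (\<lambda>ys. f ys - g ys) xs = symmetrize f xs - symmetrize g xs"
  by (simp add: symmetrize_def sum_subtractf diff_divide_distrib)

lemma symmetrize_add: "symmetrize (\<lambda>ys. f ys + g ys) xs = symmetrize f xs + symmetrize g xs"
  by (simp add: symmetrize_def sum.distrib add_divide_distrib)

lemma symmetrize_cnj: "symmetrize (\<lambda>ys. cnj (f ys)) xs = cnj (symmetrize f xs)"
  by (simp add: symmetrize_def)

section \<open>Linear equations\<close>

text \<open>Induction on the columns. If every left null vector of the old columns also kills the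
  new one, the old columns already reach \<open>b\<close>. Otherwise one that does not kill it
  determines the coefficient of the new column.\<close>

lemma fredholm_alternative:
  fixes A :: "'x \<Rightarrow> 'y \<Rightarrow> complex"
  assumes "finite Y" "finite X"
    and "\<And>c. (\<And>y. y \<in> Y \<Longrightarrow> (\<Sum>x\<in>X. c x * A x y) = 0) \<Longrightarrow> (\<Sum>x\<in>X. c x * b x) = 0"
  shows "\<exists>t. \<forall>x\<in>X. (\<Sum>y\<in>Y. A x y * t y) = b x"
  using assms(1,3)
proof (induction Y arbitrary: b rule: finite_induct)
  case empty
  have "b x = 0" if "x \<in> X" for x
    using empty[of "\<lambda>z. of_bool (z = x)"] that assms(2)
    by (simp add: of_bool_def if_distrib[of "\<lambda>a. a * _"] cong: if_cong)
  then show ?case by simp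
next
  case (insert y Y)
  have *: ?case if t: "\<forall>x\<in>X. (\<Sum>y\<in>Y. A x y * t y) = b x - r * A x y" for t r
  proof (intro exI[of _ "t(y := r)"] ballI)
    fix x assume "x \<in> X"
    have "(\<Sum>z\<in>Y. A x z * (t(y := r)) z) = (\<Sum>z\<in>Y. A x z * t z)"
      using insert.hyps by (intro sum.cong) auto
    then show "(\<Sum>z\<in>insert y Y. A x z * (t(y := r)) z) = b x"
      using t insert.hyps \<open>x \<in> X\<close> by simp
  qed
  show ?case
  proof (cases "\<exists>c. (\<forall>z\<in>Y. (\<Sum>x\<in>X. c x * A x z) = 0) \<and> (\<Sum>x\<in>X. c x * A x y) \<noteq> 0")
    case False
    then have "\<exists>t. \<forall>x\<in>X. (\<Sum>z\<in>Y. A x z * t z) = b x"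
      by (intro insert.IH insert.prems) auto
    then show ?thesis
      using *[where r = 0] by auto
  next
    case True
    then obtain c0 where c0: "\<And>z. z \<in> Y \<Longrightarrow> (\<Sum>x\<in>X. c0 x * A x z) = 0"
      and n0: "(\<Sum>x\<in>X. c0 x * A x y) \<noteq> 0" (is "?n \<noteq> 0") by auto
    \<comment> \<open>Pairing the equations with \<open>c0\<close> removes the old columns, so this
      is the only possible coefficient of column \<open>y\<close>.\<close>
    define r where "r = (\<Sum>x\<in>X. c0 x * b x) / ?n"
    have "\<exists>t. \<forall>x\<in>X. (\<Sum>z\<in>Y. A x z * t z) = b x - r * A x y"
    proof (rule insert.IH)
      fix c assume c: "\<And>z. z \<in> Y \<Longrightarrow> (\<Sum>x\<in>X. c x * A x z) = 0"
      \<comment> \<open>Subtracting this multiple of \<open>c0\<close> makes the functional kill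
        column \<open>y\<close> as well, so the premise about \<open>b\<close> applies.\<close>
      define k where "k = (\<Sum>x\<in>X. c x * A x y) / ?n"
      have lin: "(\<Sum>x\<in>X. (c x - k * c0 x) * h x) = (\<Sum>x\<in>X. c x * h x) - k * (\<Sum>x\<in>X. c0 x * h x)" for h
        by (simp add: algebra_simps sum_subtractf sum_distrib_left)
      have "(\<Sum>x\<in>X. (c x - k * c0 x) * b x) = 0"
      proof (rule insert.prems)
        fix z assume "z \<in> insert y Y"
        then show "(\<Sum>x\<in>X. (c x - k * c0 x) * A x z) = 0"
          unfolding lin using c c0 n0 by (auto simp: k_def)
      qed
      then have "(\<Sum>x\<in>X. c x * b x) = k * (\<Sum>x\<in>X. c0 x * b x)"
        by (simp add: lin)
      also have "\<dots> = r * (\<Sum>x\<in>X. c x * A x y)"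
        using n0 by (simp add: k_def r_def)
      finally show "(\<Sum>x\<in>X. c x * (b x - r * A x y)) = 0"
        by (simp add: algebra_simps sum_subtractf sum_distrib_left)
    qed
    then show ?thesis using * by blast
  qed
qed

text \<open>The fibre sums form a linear system whose rows are the fibres of \<alpha> and of
  \<beta>. A left null vector is a pair with
  \<open>\<phi> \<circ> \<alpha> + \<psi> \<circ> \<beta> = 0\<close> on \<open>Y\<close>, so
  \<open>compat\<close> is the solvability condition of the Fredholm alternative.\<close>

lemma prescribed_fibre_sums:
  fixes g :: "'a \<Rightarrow> complex" and k :: "'b \<Rightarrow> complex"
  assumes Y: "finite Y"
    and compat: "\<And>\<phi> \<psi>. (\<And>y. y \<in> Y \<Longrightarrow> \<phi> (\<alpha> y) + \<psi> (\<beta> y) = 0) \<Longrightarrow>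
      (\<Sum>a\<in>\<alpha> ` Y. \<phi> a * g a) + (\<Sum>b\<in>\<beta> ` Y. \<psi> b * k b) = 0"
  obtains t where "\<And>a. a \<in> \<alpha> ` Y \<Longrightarrow> (\<Sum>y | y \<in> Y \<and> \<alpha> y = a. t y) = g a"
    and "\<And>b. b \<in> \<beta> ` Y \<Longrightarrow> (\<Sum>y | y \<in> Y \<and> \<beta> y = b. t y) = k b"
proof -
  define A where "A x y = (case x of Inl a \<Rightarrow> (of_bool (\<alpha> y = a) :: complex) | Inr b \<Rightarrow> (of_bool (\<beta> y = b) :: complex))" for x y
  have "\<exists>t. \<forall>x \<in> \<alpha> ` Y <+> \<beta> ` Y. (\<Sum>y\<in>Y. A x y * t y) = case_sum g k x"
  proof (rule fredholm_alternative)
    fix c assume c: "\<And>y. y \<in> Y \<Longrightarrow> (\<Sum>x \<in> \<alpha> ` Y <+> \<beta> ` Y. c x * A x y) = 0"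
    have "c (Inl (\<alpha> y)) + c (Inr (\<beta> y)) = 0" if "y \<in> Y" for y
      using c[OF that] Y that
      by (simp add: sum.Plus A_def of_bool_def if_distrib[of "\<lambda>a. _ * a"] cong: if_cong)
    from compat[of "\<lambda>a. c (Inl a)" "\<lambda>b. c (Inr b)", OF this] show "(\<Sum>x \<in> \<alpha> ` Y <+> \<beta> ` Y. c x * case_sum g k x) = 0"
      using Y by (simp add: sum.Plus)
  qed (use Y in auto)
  then obtain t where t: "\<And>x. x \<in> \<alpha> ` Y <+> \<beta> ` Y \<Longrightarrow> (\<Sum>y\<in>Y. A x y * t y) = case_sum g k x"
    by blast
  show ?thesis
  proof
    show "(\<Sum>y | y \<in> Y \<and> \<alpha> y = a. t y) = g a" if "a \<in> \<alpha> ` Y" for a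
      using t[of "Inl a"] that Y
      by (simp add: A_def of_bool_def if_distrib[of "\<lambda>a. a * _"] sum.inter_filter InlI cong: if_cong)
    show "(\<Sum>y | y \<in> Y \<and> \<beta> y = b. t y) = k b" if "b \<in> \<beta> ` Y" for b
      using t[of "Inr b"] that Y
      by (simp add: A_def of_bool_def if_distrib[of "\<lambda>a. a * _"] sum.inter_filter InrI cong: if_cong)
  qed
qed

section \<open>Polynomial identities\<close>

text \<open>Substituting \<open>s = (1, t, t\<^bsup>L+1\<^esup>)\<close> separates the monomials of degree \<open>L\<close>.\<close>

lemma mset_weighted_sum_eq_0:
  fixes h :: "3 list \<Rightarrow> complex"
  assumes "\<And>s. (\<Sum>xs\<in>tuples L. s_prod s xs * h xs) = 0"
  shows "(\<Sum>xs\<in>tuples L. \<theta> (mset xs) * h xs) = 0"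
proof -
  \<comment> \<open>The exponent of \<open>t\<close> in the monomial of \<open>xs\<close>. The
    numbers of 2s and 3s are its digits in base \<open>L + 1\<close>; with the fixed length
    \<open>L\<close> they determine the multiset.\<close>
  define e where "e xs = count_list xs 2 + Suc L * count_list xs 3" for xs :: "3 list"
  define D where "D = L + Suc L * L"
  define c where "c i = (\<Sum>xs | xs \<in> tuples L \<and> e xs = i. h xs)" for i
  have le: "count_list xs i \<le> L" if "xs \<in> tuples L" for xs i
    using that count_le_length[of xs i] by (simp add: tuples_def)
  have eD: "e ` tuples L \<subseteq> {..D}"
    using le by (auto simp: e_def D_def intro!: add_mono mult_le_mono2)
  have inj: "mset xs = mset ys" if xs: "xs \<in> tuples L" and ys: "ys \<in> tuples L" and e: "e xs = e ys" for xs ys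
  proof -
    have "e zs mod Suc L = count_list zs 2" "e zs div Suc L = count_list zs 3" if "zs \<in> tuples L" for zs
      using le[OF that, of 2] unfolding e_def
      by (simp_all only: mod_mult_self2 div_mult_self2[OF nat.distinct(2)] mod_less div_less less_Suc_eq_le add_0_right)
    with xs ys e have 23: "count_list xs 2 = count_list ys 2" "count_list xs 3 = count_list ys 3"
      by metis+
    have tot: "length zs = count_list zs 1 + count_list zs 2 + count_list zs 3" for zs :: "3 list"
    proof (induction zs)
      case (Cons z zs)
      then show ?case using exhaust_3[of z] by auto
    qed simp
    have "count_list xs i = count_list ys i" for i
      using 23 tot[of xs] tot[of ys] xs ys exhaust_3[of i] by (auto simp: tuples_def)
    then show ?thesis
      by (auto intro!: multiset_eqI simp: count_mset)
  qed
  have "(\<Sum>i\<le>D. c i * of_real t ^ i) = 0" for t :: real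
  proof -
    define s :: "real^3" where "s = vector [1, t, t ^ Suc L]"
    have sp: "s_prod s xs = of_real t ^ e xs" for xs
    proof (induction xs)
      case (Cons x xs)
      then show ?case using exhaust_3[of x]
        by (auto simp: s_prod_def e_def s_def power_add power_mult)
    qed (simp add: s_prod_def e_def)
    have "(\<Sum>i\<le>D. c i * of_real t ^ i) = (\<Sum>i\<le>D. \<Sum>xs | xs \<in> tuples L \<and> e xs = i. s_prod s xs * h xs)"
      unfolding c_def sum_distrib_right by (intro sum.cong refl) (auto simp: sp)
    also have "\<dots> = (\<Sum>xs\<in>tuples L. s_prod s xs * h xs)"
      by (rule sum.group) (use eD in auto)
    finally show ?thesis
      using assms by simp
  qed
  \<comment> \<open>The real values of \<open>t\<close> already give infinitely many roots, so all
    coefficients vanish.\<close>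
  then have "range complex_of_real \<subseteq> {z. (\<Sum>i\<le>D. c i * z ^ i) = 0}"
    by auto
  moreover have "infinite (range complex_of_real)"
    using finite_imageD[of complex_of_real UNIV] infinite_UNIV_char_0 by (auto simp: inj_of_real)
  ultimately have c0: "c i = 0" if "i \<le> D" for i
    using polyfun_finite_roots[of c D] that finite_subset by blast
  have "(\<Sum>xs\<in>tuples L. \<theta> (mset xs) * h xs)
      = (\<Sum>i\<le>D. \<Sum>xs | xs \<in> tuples L \<and> e xs = i. \<theta> (mset xs) * h xs)"
    by (rule sum.group[symmetric]) (use eD in auto)
  also have "\<dots> = (\<Sum>i\<le>D. 0)"
  proof (rule sum.cong[OF refl])
    fix i assume i: "i \<in> {..D}"
    show "(\<Sum>xs | xs \<in> tuples L \<and> e xs = i. \<theta> (mset xs) * h xs) = 0"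
    proof (cases "\<exists>ys. ys \<in> tuples L \<and> e ys = i")
      case True
      then obtain ys where ys: "ys \<in> tuples L" "e ys = i" by blast
      have "(\<Sum>xs | xs \<in> tuples L \<and> e xs = i. \<theta> (mset xs) * h xs) = \<theta> (mset ys) * c i"
        unfolding c_def sum_distrib_left using inj[OF _ ys(1)] ys(2) by (intro sum.cong refl) auto
      then show ?thesis using c0 i by simp
    qed (auto intro!: sum.neutral)
  qed
  finally show ?thesis by simp
qed

section \<open>Tensors with prescribed symmetrizations\<close>

lemma finite_mset_class [simp]: "finite {xs. mset xs = M}"
  using mset_eq_finite ex_mset by metis

lemma symmetrize_eq_class_sum:
  "symmetrize f xs = (\<Sum>ys | mset ys = mset xs. f ys) / of_nat (card {ys. mset ys = mset xs})"
proof -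
  have "{ys \<in> tuples (length xs). mset ys = mset xs} = {ys. mset ys = mset xs}"
    using mset_eq_length by (auto simp: tuples_def)
  then show ?thesis
    by (simp add: symmetrize_eq_class_avg class_avg_def)
qed

lemma card_mset_class_neq_0: "card {xs. mset xs = M} \<noteq> 0"
  using ex_mset[of M] by (auto simp: card_eq_0_iff)

text \<open>A rearrangement of a nonempty \<open>K\<close> is a choice of its head followed by a
  rearrangement of the rest; \<open>set_mset\<close> counts each head once, however often it occurs
  in \<open>K\<close>.\<close>

lemma sum_mset_class_Cons:
  assumes "K \<noteq> {#}"
  shows "(\<Sum>kk | mset kk = K. F (hd kk) (tl kk)) = (\<Sum>p\<in>set_mset K. \<Sum>jj | mset jj = K - {#p#}. F p jj)"
proof -
  have "(\<Sum>p\<in>set_mset K. \<Sum>jj | mset jj = K - {#p#}. F p jj)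
      = (\<Sum>(p, jj)\<in>Sigma (set_mset K) (\<lambda>p. {jj. mset jj = K - {#p#}}). F p jj)"
    by (rule sum.Sigma) auto
  also have "\<dots> = (\<Sum>kk | mset kk = K. F (hd kk) (tl kk))"
  proof (rule sum.reindex_bij_witness[where i="\<lambda>kk. (hd kk, tl kk)" and j="\<lambda>(p, jj). p # jj"])
    fix kk assume "kk \<in> {kk. mset kk = K}"
    with assms show "(hd kk, tl kk) \<in> Sigma (set_mset K) (\<lambda>p. {jj. mset jj = K - {#p#}})"
      "(case (hd kk, tl kk) of (p, jj) \<Rightarrow> p # jj) = kk"
      by (cases kk; auto)+
  qed auto
  finally show ?thesis ..
qed

text \<open>Eliminating \<psi> between two instances of \<open>ex\<close> shows that \<phi> is
  unchanged when an element of \<open>M\<close> is exchanged with one of \<open>K\<close>. Such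
  exchanges lead from one splitting of a multiset to any other of the same sizes, so \<phi> depends
  on the union only.\<close>

lemma exchange_invariant:
  fixes \<phi> \<psi> :: "'a multiset \<Rightarrow> 'a multiset \<Rightarrow> complex"
  assumes ex: "\<And>M p M'. size M = m \<Longrightarrow> size M' = n \<Longrightarrow> \<phi> M (add_mset p M') + \<psi> (add_mset p M) M' = 0"
    and "size M = m" "size M1 = m" "size K = Suc n" "M + K = M1 + K1"
  shows "\<phi> M K = \<phi> M1 K1"
  using assms(2,4,5)
proof (induction "size (M - M1)" arbitrary: M K)
  case 0
  then have "M \<subseteq># M1" by (simp add: Diff_eq_empty_iff_mset)
  then have "M = M1"
    using 0 assms(3) by (metis mset_subset_size nat_less_le subset_mset.le_less)
  then show ?case using 0 by simp
next
  case (Suc d)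
  \<comment> \<open>An element of which \<open>M\<close> has too many is exchanged for one of which
    it has too few; equality of the unions ensures that the latter occurs in
    \<open>K\<close>.\<close>
  then obtain x where x: "x \<in># M - M1"
    by (metis multiset_nonemptyE nat.distinct(1) size_empty)
  have "M1 - M \<noteq> {#}"
  proof
    assume "M1 - M = {#}"
    then have "M1 \<subseteq># M" by (simp add: Diff_eq_empty_iff_mset)
    then have "M1 = M"
      using Suc assms(3) by (metis mset_subset_size nat_less_le subset_mset.le_less)
    then show False using x by simp
  qed
  then obtain y where y: "y \<in># M1 - M" by (metis multiset_nonemptyE)
  have xy: "count M1 x < count M x" "count M y < count M1 y"
    using x y by (simp_all add: in_diff_count)
  have "count M y + count K y = count M1 y + count K1 y"
    using Suc(5) by (metis count_union)
  then have yK: "y \<in># K"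
    using xy(2) by (simp add: count_inI)
  obtain M0 where M0: "M = add_mset x M0"
    using in_diffD[OF x] by (metis insert_DiffM)
  obtain K0 where K0: "K = add_mset y K0"
    using yK by (metis insert_DiffM)
  have sz: "size (add_mset y M0) = m" "size (add_mset x K0) = Suc n" "size K0 = n"
    using Suc(3,4) M0 K0 by auto
  have eq: "add_mset y M0 + add_mset x K0 = M1 + K1"
    using Suc(5) M0 K0 by (simp add: add_mset_commute)
  have "M - M1 = add_mset x (add_mset y M0 - M1)"
  proof (rule multiset_eqI)
    fix z
    show "count (M - M1) z = count (add_mset x (add_mset y M0 - M1)) z"
      using xy M0 by auto
  qed
  then have "size (add_mset y M0 - M1) = d"
    using Suc(2) by simp
  with Suc(1)[of "add_mset y M0" "add_mset x K0"] sz eq have IH: "\<phi> (add_mset y M0) (add_mset x K0) = \<phi> M1 K1"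
    by simp
  have "\<phi> M K + \<psi> (add_mset y M) K0 = 0" "\<phi> (add_mset y M0) (add_mset x K0) + \<psi> (add_mset x (add_mset y M0)) K0 = 0"
    using ex[of M K0 y] ex[of "add_mset y M0" K0 x] sz Suc(3) K0 by auto
  \<comment> \<open>Both values of \<psi> are taken at \<open>M0\<close> enlarged by
    \<open>x\<close> and \<open>y\<close>, so they cancel.\<close>
  then have "\<phi> M K = \<phi> (add_mset y M0) (add_mset x K0)"
    using M0 by (simp add: add_mset_commute) (metis add_right_cancel)
  then show ?case using IH by simp
qed

lemma sum_tuples_append:
  "(\<Sum>ii\<in>tuples m. \<Sum>kk\<in>tuples n. f ii kk) = (\<Sum>xs\<in>tuples (m + n). f (take m xs) (drop m xs))"
proof -
  have "(\<Sum>ii\<in>tuples m. \<Sum>kk\<in>tuples n. f ii kk) = (\<Sum>(ii, kk)\<in>tuples m \<times> tuples n. f ii kk)"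
    by (rule sum.cartesian_product)
  also have "\<dots> = (\<Sum>xs\<in>tuples (m + n). f (take m xs) (drop m xs))"
    by (rule sum.reindex_bij_witness[where i="\<lambda>xs. (take m xs, drop m xs)" and j="\<lambda>(ii, kk). ii @ kk"])
      (auto simp: tuples_def)
  finally show ?thesis .
qed

lemma s_prod_append: "s_prod s (xs @ ys) = s_prod s xs * s_prod s ys"
  by (simp add: s_prod_def)

text \<open>Both double sums are forms of degree \<open>m + n + 1\<close> in \<open>s\<close>. If
  they agree for all \<open>s\<close>, the coefficients of every monomial agree; a monomial
  corresponds to the multiset of all indices, so the powers of \<open>s\<close> may be replaced by
  any weight \<theta>.\<close>

lemma equal_total_symmetrization:
  fixes G K :: "3 list \<Rightarrow> 3 list \<Rightarrow> complex"
  assumes compat: "\<And>s. (\<Sum>ii\<in>tuples m. \<Sum>kk\<in>tuples (Suc n). s_prod s ii * s_prod s kk * G ii kk)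
      = (\<Sum>kk\<in>tuples (Suc m). \<Sum>jj\<in>tuples n. s_prod s kk * s_prod s jj * K kk jj)"
  shows "(\<Sum>ii\<in>tuples m. \<Sum>kk\<in>tuples (Suc n). \<theta> (mset ii + mset kk) * G ii kk)
      = (\<Sum>kk\<in>tuples (Suc m). \<Sum>jj\<in>tuples n. \<theta> (mset kk + mset jj) * K kk jj)"
proof -
  \<comment> \<open>The same concatenated list is cut after \<open>m\<close> indices for
    \<open>G\<close> and after \<open>m + 1\<close> for \<open>K\<close>.\<close>
  define h where "h xs = G (take m xs) (drop m xs) - K (take (Suc m) xs) (drop (Suc m) xs)" for xs
  have sp: "s_prod s (take k xs) * s_prod s (drop k xs) = s_prod s xs" for s k xs
    by (simp flip: s_prod_append)
  have "(\<Sum>xs\<in>tuples (m + Suc n). s_prod s xs * h xs) = 0" for s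
    using compat[of s] unfolding sum_tuples_append sp
    by (simp add: h_def right_diff_distrib sum_subtractf)
  from mset_weighted_sum_eq_0[OF this, of \<theta>]
  have "(\<Sum>xs\<in>tuples (m + Suc n). \<theta> (mset xs) * h xs) = 0" .
  then show ?thesis
    unfolding sum_tuples_append
    by (simp add: h_def right_diff_distrib sum_subtractf flip: mset_append)
qed

text \<open>A tensor symmetric in its first \<open>m\<close> and last \<open>n\<close> indices
  amounts to a function of triples (multiset, index, multiset). The two conditions prescribe its
  sums over the fibres of the maps that merge the index with the right or with the left multiset;
  solvability comes from \<open>equal_total_symmetrization\<close>.\<close>

lemma tensor_with_symmetrizations:
  fixes G K :: "3 list \<Rightarrow> 3 list \<Rightarrow> complex"
  assumes G: "\<And>ii ii' kk. length ii = m \<Longrightarrow> mset ii = mset ii' \<Longrightarrow> G ii kk = G ii' kk"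
    and K: "\<And>kk jj jj'. length jj = n \<Longrightarrow> mset jj = mset jj' \<Longrightarrow> K kk jj = K kk jj'"
    and compat: "\<And>s. (\<Sum>ii\<in>tuples m. \<Sum>kk\<in>tuples (Suc n). s_prod s ii * s_prod s kk * G ii kk)
      = (\<Sum>kk\<in>tuples (Suc m). \<Sum>jj\<in>tuples n. s_prod s kk * s_prod s jj * K kk jj)"
  obtains T where
    "\<And>ii ii' p jj. mset ii = mset ii' \<Longrightarrow> T ii p jj = T ii' p jj"
    "\<And>ii p jj jj'. mset jj = mset jj' \<Longrightarrow> T ii p jj = T ii p jj'"
    "\<And>ii kk. ii \<in> tuples m \<Longrightarrow> kk \<in> tuples (Suc n) \<Longrightarrow>
      symmetrize (\<lambda>kk. T ii (hd kk) (tl kk)) kk = symmetrize (G ii) kk"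
    "\<And>kk jj. kk \<in> tuples (Suc m) \<Longrightarrow> jj \<in> tuples n \<Longrightarrow>
      symmetrize (\<lambda>kk. T (tl kk) (hd kk) jj) kk = symmetrize (\<lambda>kk. K kk jj) kk"
proof -
  let ?M = "\<lambda>r. mset ` tuples r"
  define Y where "Y = ?M m \<times> (UNIV :: 3 set) \<times> ?M n"
  define \<alpha> :: "3 multiset \<times> 3 \<times> 3 multiset \<Rightarrow> 3 multiset \<times> 3 multiset"
    where "\<alpha> = (\<lambda>(M, p, M'). (M, add_mset p M'))"
  define \<beta> :: "3 multiset \<times> 3 \<times> 3 multiset \<Rightarrow> 3 multiset \<times> 3 multiset"
    where "\<beta> = (\<lambda>(M, p, M'). (add_mset p M, M'))"
  \<comment> \<open>Totals of \<open>G\<close> and \<open>K\<close> over all index lists with given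
    multisets, the form in which they prescribe fibre sums.\<close>
  define g where "g a = (\<Sum>x | x \<in> tuples m \<times> tuples (Suc n) \<and> (mset (fst x), mset (snd x)) = a. G (fst x) (snd x))" for a
  define k where "k b = (\<Sum>x | x \<in> tuples (Suc m) \<times> tuples n \<and> (mset (fst x), mset (snd x)) = b. K (fst x) (snd x))" for b
  have M: "M \<in> ?M r \<longleftrightarrow> size M = r" for M r
    using ex_mset[of M] by (auto simp: tuples_def image_iff)
  have len: "xs \<in> tuples r \<longleftrightarrow> length xs = r" for xs r
    by (simp add: tuples_def)
  have Suc_M: "(\<exists>p M'. size M' = r \<and> K = add_mset p M') \<longleftrightarrow> size K = Suc r" for K :: "3 multiset" and r
    using size_eq_Suc_imp_eq_union[of K r] by force
  have \<alpha>Y: "\<alpha> ` Y = ?M m \<times> ?M (Suc n)"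
  proof (intro set_eqI iffI)
    fix a assume "a \<in> ?M m \<times> ?M (Suc n)"
    then obtain p M' where "size M' = n" "a = \<alpha> (fst a, p, M')" "size (fst a) = m"
      using Suc_M[of n "snd a"] by (cases a) (auto simp: M \<alpha>_def)
    then show "a \<in> \<alpha> ` Y" by (intro image_eqI[of _ _ "(fst a, p, M')"]) (auto simp: Y_def M)
  qed (auto simp: Y_def \<alpha>_def M len)
  have \<beta>Y: "\<beta> ` Y = ?M (Suc m) \<times> ?M n"
  proof (intro set_eqI iffI)
    fix a assume "a \<in> ?M (Suc m) \<times> ?M n"
    then obtain p M' where "size M' = m" "a = \<beta> (M', p, snd a)" "size (snd a) = n"
      using Suc_M[of m "fst a"] by (cases a) (auto simp: M \<beta>_def)
    then show "a \<in> \<beta> ` Y" by (intro image_eqI[of _ _ "(M', p, snd a)"]) (auto simp: Y_def M)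
  qed (auto simp: Y_def \<beta>_def M len)
  have "finite Y" by (simp add: Y_def)
  \<comment> \<open>The exchange argument turns a null pair into \<theta> and its negative for a
    function \<theta> of the total multiset; the two sums then compare the total symmetrizations of
    \<open>G\<close> and \<open>K\<close>.\<close>
  have orth: "(\<Sum>a\<in>\<alpha> ` Y. \<phi> a * g a) + (\<Sum>b\<in>\<beta> ` Y. \<psi> b * k b) = 0"
    if van: "\<And>y. y \<in> Y \<Longrightarrow> \<phi> (\<alpha> y) + \<psi> (\<beta> y) = 0" for \<phi> \<psi>
  proof -
    have ex: "curry \<phi> M (add_mset p M') + curry \<psi> (add_mset p M) M' = 0"
      if "size M = m" "size M' = n" for M p M'
      using van[of "(M, p, M')"] that by (auto simp: Y_def M \<alpha>_def \<beta>_def)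
    \<comment> \<open>Any splitting of \<Theta> may be chosen, by
      \<open>exchange_invariant\<close>.\<close>
    define \<theta> where "\<theta> \<Theta> = (SOME c. \<exists>M K. size M = m \<and> size K = Suc n \<and> \<Theta> = M + K \<and> c = \<phi> (M, K))" for \<Theta>
    have \<phi>: "\<phi> (M, K) = \<theta> (M + K)" if "size M = m" "size K = Suc n" for M K
    proof -
      have "\<exists>M' K'. size M' = m \<and> size K' = Suc n \<and> M + K = M' + K' \<and> \<theta> (M + K) = \<phi> (M', K')"
        unfolding \<theta>_def by (rule someI_ex) (use that in blast)
      then show ?thesis
        using exchange_invariant[of m n "curry \<phi>" "curry \<psi>", OF ex] that by (metis curry_conv)
    qed
    have \<psi>: "\<psi> (K, M') = - \<theta> (K + M')" if K: "size K = Suc m" "size M' = n" for K M'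
    proof -
      obtain p M where "size M = m" "K = add_mset p M"
        using K Suc_M[of m K] by auto
      then show ?thesis
        using ex[of M M' p] \<phi>[of M "add_mset p M'"] K by (simp add: add_eq_0_iff)
    qed
    have "(\<Sum>a\<in>\<alpha> ` Y. \<phi> a * g a)
        = (\<Sum>a\<in>\<alpha> ` Y. \<Sum>x | x \<in> tuples m \<times> tuples (Suc n) \<and> (mset (fst x), mset (snd x)) = a.
            \<phi> (mset (fst x), mset (snd x)) * G (fst x) (snd x))"
      unfolding g_def sum_distrib_left by (intro sum.cong refl) auto
    also have "\<dots> = (\<Sum>x\<in>tuples m \<times> tuples (Suc n). \<phi> (mset (fst x), mset (snd x)) * G (fst x) (snd x))"
      by (rule sum.group) (auto simp: \<alpha>Y)
    also have "\<dots> = (\<Sum>ii\<in>tuples m. \<Sum>kk\<in>tuples (Suc n). \<theta> (mset ii + mset kk) * G ii kk)"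
      unfolding sum.cartesian_product by (intro sum.cong refl) (auto simp: \<phi> tuples_def)
    finally have 1: "(\<Sum>a\<in>\<alpha> ` Y. \<phi> a * g a) = \<dots>" .
    have "(\<Sum>b\<in>\<beta> ` Y. \<psi> b * k b)
        = (\<Sum>b\<in>\<beta> ` Y. \<Sum>x | x \<in> tuples (Suc m) \<times> tuples n \<and> (mset (fst x), mset (snd x)) = b.
            \<psi> (mset (fst x), mset (snd x)) * K (fst x) (snd x))"
      unfolding k_def sum_distrib_left by (intro sum.cong refl) auto
    also have "\<dots> = (\<Sum>x\<in>tuples (Suc m) \<times> tuples n. \<psi> (mset (fst x), mset (snd x)) * K (fst x) (snd x))"
      by (rule sum.group) (auto simp: \<beta>Y)
    also have "\<dots> = - (\<Sum>kk\<in>tuples (Suc m). \<Sum>jj\<in>tuples n. \<theta> (mset kk + mset jj) * K kk jj)"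
      unfolding sum.cartesian_product sum_negf[symmetric]
      by (intro sum.cong refl) (auto simp: \<psi> tuples_def)
    finally show ?thesis
      using 1 equal_total_symmetrization[OF compat, of \<theta>] by simp
  qed
  obtain t where t1: "\<And>a. a \<in> \<alpha> ` Y \<Longrightarrow> (\<Sum>y | y \<in> Y \<and> \<alpha> y = a. t y) = g a"
    and t2: "\<And>b. b \<in> \<beta> ` Y \<Longrightarrow> (\<Sum>y | y \<in> Y \<and> \<beta> y = b. t y) = k b"
    by (rule prescribed_fibre_sums[where g=g and k=k, OF \<open>finite Y\<close> orth]) (assumption | blast)+
  define c where "c M = (of_nat (card {xs :: 3 list. mset xs = M}) :: complex)" for M
  have c0: "c M \<noteq> 0" for M
    using card_mset_class_neq_0 by (simp add: c_def)
  \<comment> \<open>\<open>t\<close> is spread evenly over the index lists with the given multisets,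
    so that summing \<open>T\<close> over them gives back \<open>t\<close>.\<close>
  define T where "T ii p jj = t (mset ii, p, mset jj) / (c (mset ii) * c (mset jj))" for ii p jj
  have ne: "mset kk \<noteq> {#}" if "length kk = Suc r" for kk :: "3 list" and r
    using that by auto
  have rem: "mset kk - {#a#} = N" "a \<in> set kk" if "add_mset a N = mset kk" for a N and kk :: "3 list"
    using that by (metis add_mset_remove_trivial, metis union_single_eq_member set_mset_mset)
  show ?thesis
  proof
    fix ii kk assume ii: "ii \<in> tuples m" and kk: "kk \<in> tuples (Suc n)"
    have "(\<Sum>ys | mset ys = mset kk. T ii (hd ys) (tl ys))
        = (\<Sum>p\<in>set_mset (mset kk). \<Sum>jj | mset jj = mset kk - {#p#}. T ii p jj)"
      using kk by (intro sum_mset_class_Cons ne) (simp add: tuples_def)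
    also have "\<dots> = (\<Sum>p\<in>set_mset (mset kk). t (mset ii, p, mset kk - {#p#}) / c (mset ii))"
      using c0 by (intro sum.cong refl) (simp add: T_def flip: c_def)
    \<comment> \<open>A point of this fibre is determined by the element \<open>p\<close> taken out
      of \<open>mset kk\<close>.\<close>
    also have "\<dots> = (\<Sum>y | y \<in> Y \<and> \<alpha> y = (mset ii, mset kk). t y) / c (mset ii)"
      unfolding sum_divide_distrib using ii kk
      by (intro sum.reindex_bij_witness[where j="\<lambda>p. (mset ii, p, mset kk - {#p#})" and i="\<lambda>(M, p, M'). p"])
        (auto simp: Y_def \<alpha>_def M len size_Diff_singleton dest: rem)
    also have "\<dots> = g (mset ii, mset kk) / c (mset ii)"
      by (subst t1) (use ii kk in \<open>auto simp: \<alpha>Y\<close>)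
    \<comment> \<open>Symmetry of \<open>G\<close> in its first argument makes all
      \<open>c (mset ii)\<close> rows equal, which cancels the remaining divisor.\<close>
    also have "g (mset ii, mset kk) = (\<Sum>(xs, ys)\<in>{xs. mset xs = mset ii} \<times> {ys. mset ys = mset kk}. G ii ys)"
      unfolding g_def
    proof (rule sum.cong)
      show "{x \<in> tuples m \<times> tuples (Suc n). (mset (fst x), mset (snd x)) = (mset ii, mset kk)}
          = {xs. mset xs = mset ii} \<times> {ys. mset ys = mset kk}"
        using ii kk by (auto simp: tuples_def dest: mset_eq_length)
      fix x assume "x \<in> {xs. mset xs = mset ii} \<times> {ys. mset ys = mset kk}"
      then show "G (fst x) (snd x) = (case x of (xs, ys) \<Rightarrow> G ii ys)"
        using G[of ii "fst x" "snd x"] ii by (simp add: tuples_def split_beta mem_Times_iff)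
    qed
    also have "\<dots> = c (mset ii) * (\<Sum>ys | mset ys = mset kk. G ii ys)"
      by (simp add: c_def flip: sum.cartesian_product)
    finally show "symmetrize (\<lambda>kk. T ii (hd kk) (tl kk)) kk = symmetrize (G ii) kk"
      using c0 by (simp add: symmetrize_eq_class_sum)
  next
    fix kk jj assume kk: "kk \<in> tuples (Suc m)" and jj: "jj \<in> tuples n"
    have "(\<Sum>ys | mset ys = mset kk. T (tl ys) (hd ys) jj)
        = (\<Sum>p\<in>set_mset (mset kk). \<Sum>ii | mset ii = mset kk - {#p#}. T ii p jj)"
      using kk by (intro sum_mset_class_Cons[where F="\<lambda>p ii. T ii p jj"] ne) (simp add: tuples_def)
    also have "\<dots> = (\<Sum>p\<in>set_mset (mset kk). t (mset kk - {#p#}, p, mset jj) / c (mset jj))"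
      using c0 by (intro sum.cong refl) (simp add: T_def flip: c_def)
    also have "\<dots> = (\<Sum>y | y \<in> Y \<and> \<beta> y = (mset kk, mset jj). t y) / c (mset jj)"
      unfolding sum_divide_distrib using jj kk
      by (intro sum.reindex_bij_witness[where j="\<lambda>p. (mset kk - {#p#}, p, mset jj)" and i="\<lambda>(M, p, M'). p"])
        (auto simp: Y_def \<beta>_def M len size_Diff_singleton dest: rem)
    also have "\<dots> = k (mset kk, mset jj) / c (mset jj)"
      by (subst t2) (use jj kk in \<open>auto simp: \<beta>Y\<close>)
    also have "k (mset kk, mset jj) = (\<Sum>(xs, ys)\<in>{xs. mset xs = mset kk} \<times> {ys. mset ys = mset jj}. K xs jj)"
      unfolding k_def
    proof (rule sum.cong)
      show "{x \<in> tuples (Suc m) \<times> tuples n. (mset (fst x), mset (snd x)) = (mset kk, mset jj)}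
          = {xs. mset xs = mset kk} \<times> {ys. mset ys = mset jj}"
        using jj kk by (auto simp: tuples_def dest: mset_eq_length)
      fix x assume "x \<in> {xs. mset xs = mset kk} \<times> {ys. mset ys = mset jj}"
      then show "K (fst x) (snd x) = (case x of (xs, ys) \<Rightarrow> K xs jj)"
        using K[of jj "snd x" "fst x"] jj by (simp add: tuples_def split_beta mem_Times_iff)
    qed
    also have "\<dots> = c (mset jj) * (\<Sum>ys | mset ys = mset kk. K ys jj)"
      by (simp add: c_def sum_distrib_left flip: sum.cartesian_product)
    finally show "symmetrize (\<lambda>kk. T (tl kk) (hd kk) jj) kk = symmetrize (\<lambda>kk. K kk jj) kk"
      using c0 by (simp add: symmetrize_eq_class_sum)
  qed (simp_all add: T_def)
qed

section \<open>Hermitian forms on symmetric states\<close>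

text \<open>Equality of classes is the orbit relation of index permutations. The multiset retains
  the rank, so variables of different ranks stay apart.\<close>

fun idx_class :: "idx \<Rightarrow> nat \<times> 3 multiset \<times> nat" where
  "idx_class (\<mu>, ii, a) = (\<mu>, mset ii, a)"

text \<open>This makes \<open>X\<close> a union of classes of \<open>idx_class\<close>, so that
  symmetry of a state on \<open>X\<close> becomes constancy on classes.\<close>

definition rank_closed :: "idx set \<Rightarrow> bool" where
  "rank_closed X \<longleftrightarrow> (\<forall>\<mu> ii jj a. (\<mu>, ii, a) \<in> X \<longrightarrow> length jj = length ii \<longrightarrow> (\<mu>, jj, a) \<in> X)"

lemma rank_closed_idx_class:
  assumes "rank_closed X" "I \<in> X" "idx_class J = idx_class I"
  shows "J \<in> X"
proof -
  obtain \<mu> ii a jj where "I = (\<mu>, ii, a)" "J = (\<mu>, jj, a)" "mset jj = mset ii"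
    using assms(3) by (cases I; cases J) auto
  then show ?thesis
    using assms(1,2) mset_eq_length[of jj ii] by (auto simp: rank_closed_def)
qed

lemma symmetric_on_iff:
  assumes "rank_closed X"
  shows "symmetric_on X u \<longleftrightarrow> (\<forall>I\<in>X. \<forall>J. idx_class J = idx_class I \<longrightarrow> u J = u I)"
proof
  assume u: "symmetric_on X u"
  show "\<forall>I\<in>X. \<forall>J. idx_class J = idx_class I \<longrightarrow> u J = u I"
  proof (intro ballI allI impI)
    fix I J assume "I \<in> X" "idx_class J = idx_class I"
    then obtain \<mu> ii a jj where "I = (\<mu>, ii, a)" "J = (\<mu>, jj, a)" "mset ii = mset jj"
      by (cases I; cases J) auto
    then show "u J = u I"
      using u \<open>I \<in> X\<close> by (auto simp: symmetric_on_def symmetric_tensor_iff)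
  qed
next
  assume u: "\<forall>I\<in>X. \<forall>J. idx_class J = idx_class I \<longrightarrow> u J = u I"
  have "u (\<mu>, xs, a) = u (\<mu>, ys, a)"
    if "(\<mu>, ii, a) \<in> X" "length xs = length ii" "mset xs = mset ys" for \<mu> ii a and xs ys :: "3 list"
  proof -
    have "(\<mu>, ys, a) \<in> X"
      using assms that mset_eq_length[OF that(3)] by (auto simp: rank_closed_def)
    from u[rule_format, OF this, of "(\<mu>, xs, a)"] show ?thesis
      using that(3) by simp
  qed
  then show "symmetric_on X u"
    unfolding symmetric_on_def symmetric_tensor_iff by blast
qed

text \<open>In the applications \<open>f\<close> is \<open>cnj\<close> or the identity; the value 0
  outside \<open>X\<close> is the normalization built into \<open>states\<close>.\<close>

lemma state_average:
  assumes "rank_closed X"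
  shows "(\<lambda>I. if I \<in> X then f (class_avg X idx_class t I) else 0) \<in> states X"
  unfolding states_def mem_Collect_eq symmetric_on_iff[OF assms]
proof (intro conjI ballI allI impI)
  fix I J assume IJ: "I \<in> X" "idx_class J = idx_class I"
  then have "J \<in> X" by (rule rank_closed_idx_class[OF assms])
  then show "(if J \<in> X then f (class_avg X idx_class t J) else 0)
      = (if I \<in> X then f (class_avg X idx_class t I) else 0)"
    using IJ(1) by (simp add: class_avg_cong_class[where c=idx_class, OF IJ(2)])
qed simp

lemma symmetric_hermitianD:
  assumes "rank_closed X" "symmetric_hermitian X H" "I \<in> X" "J \<in> X"
  shows "idx_class I' = idx_class I \<Longrightarrow> H I' J = H I J"
    and "idx_class J' = idx_class J \<Longrightarrow> H I J' = H I J"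
    and "H I J = cnj (H J I)"
proof -
  have s: "symmetric_on X (\<lambda>I. H I J)" "symmetric_on X (\<lambda>J. H I J)"
    using assms(2-) by (auto simp: symmetric_hermitian_def)
  show "idx_class I' = idx_class I \<Longrightarrow> H I' J = H I J"
    using s(1) assms(3) unfolding symmetric_on_iff[OF assms(1)] by blast
  show "idx_class J' = idx_class J \<Longrightarrow> H I J' = H I J"
    using s(2) assms(4) unfolding symmetric_on_iff[OF assms(1)] by blast
  show "H I J = cnj (H J I)"
    using assms(2-) unfolding symmetric_hermitian_def hermitian_on_def by blast
qed

text \<open>\<open>H\<close> is definite on symmetric states only and may be singular as a matrix. A
  left null vector has zero average by definiteness, and only its average pairs with the symmetric
  \<open>b\<close>, so the Fredholm alternative applies.\<close>

lemma positive_definite_solvable: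
  assumes X: "finite X" "rank_closed X" and H: "symmetric_hermitian X H" "positive_definite_on X H"
    and b: "symmetric_on X b"
  obtains t where "t \<in> states X" "\<And>I. I \<in> X \<Longrightarrow> (\<Sum>K\<in>X. H I K * t K) = b I"
proof -
  let ?avg = "class_avg X idx_class"
  note Hsym = symmetric_hermitianD[OF X(2) H(1)]
  have "\<exists>t. \<forall>I\<in>X. (\<Sum>K\<in>X. H I K * t K) = b I"
  proof (rule fredholm_alternative[OF X(1) X(1)])
    fix c assume c: "\<And>K. K \<in> X \<Longrightarrow> (\<Sum>I\<in>X. c I * H I K) = 0"
    \<comment> \<open>\<open>sesq\<close> conjugates its left argument, so the state to be tested is
      the conjugate of the averaged null vector.\<close>
    define u where "u I = (if I \<in> X then cnj (?avg c I) else 0)" for I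
    have u: "u \<in> states X"
      using state_average[OF X(2), of cnj c] by (simp add: u_def[abs_def])
    have avg0: "(\<Sum>I\<in>X. ?avg c I * H I J) = 0" if J: "J \<in> X" for J
    proof -
      have "(\<Sum>I\<in>X. ?avg c I * H I J) = (\<Sum>I\<in>X. c I * ?avg (\<lambda>I. H I J) I)"
        by (rule sum_class_avg[OF X(1)])
      also have "\<dots> = (\<Sum>I\<in>X. c I * H I J)"
      proof (rule sum.cong[OF refl])
        fix I assume I: "I \<in> X"
        have "?avg (\<lambda>I. H I J) I = H I J"
          by (rule class_avg_invariant[OF X(1) I], rule Hsym(1)[OF I J])
        then show "c I * ?avg (\<lambda>I. H I J) I = c I * H I J" by simp
      qed
      finally show ?thesis using c[OF J] by simp
    qed
    have "sesq X H u u = (\<Sum>J\<in>X. (\<Sum>I\<in>X. ?avg c I * H I J) * u J)"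
      unfolding sesq_def sum_distrib_right by (subst sum.swap) (auto simp: u_def intro!: sum.cong)
    also have "\<dots> = 0"
      using avg0 by simp
    finally have "u = (\<lambda>_. 0)"
      using H(2) u unfolding positive_definite_on_def by force
    then have avg: "?avg c I = 0" if "I \<in> X" for I
      using that by (metis complex_cnj_zero_iff u_def)
    have "?avg b I = b I" if I: "I \<in> X" for I
      by (rule class_avg_invariant[OF X(1) I], rule b[unfolded symmetric_on_iff[OF X(2)], rule_format, OF I])
    then have "(\<Sum>I\<in>X. c I * b I) = (\<Sum>I\<in>X. c I * ?avg b I)"
      by (simp cong: sum.cong)
    also have "\<dots> = (\<Sum>I\<in>X. ?avg c I * b I)"
      by (rule sum_class_avg[OF X(1), symmetric])
    finally show "(\<Sum>I\<in>X. c I * b I) = 0"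
      using avg by simp
  qed
  then obtain t where t: "\<And>I. I \<in> X \<Longrightarrow> (\<Sum>K\<in>X. H I K * t K) = b I" by blast
  show ?thesis
  proof
    \<comment> \<open>Averaging a solution yields a symmetric one, which still solves because the
      rows of \<open>H\<close> are invariant.\<close>
    show "(\<lambda>I. if I \<in> X then id (?avg t I) else 0) \<in> states X"
      using state_average[OF X(2), of id t] by simp
    fix I assume I: "I \<in> X"
    have "(\<Sum>K\<in>X. H I K * (if K \<in> X then id (?avg t K) else 0)) = (\<Sum>K\<in>X. ?avg (H I) K * t K)"
      using sum_class_avg[OF X(1), of idx_class "H I" t] by (simp cong: sum.cong)
    also have "\<dots> = (\<Sum>K\<in>X. H I K * t K)"
    proof (rule sum.cong[OF refl])
      fix K assume K: "K \<in> X"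
      have "?avg (H I) K = H I K"
        by (rule class_avg_invariant[OF X(1) K], rule Hsym(2)[OF I K])
      then show "?avg (H I) K * t K = H I K * t K" by simp
    qed
    finally show "(\<Sum>K\<in>X. H I K * (if K \<in> X then id (?avg t K) else 0)) = b I"
      using t[OF I] by simp
  qed
qed

text \<open>Column \<open>J\<close> of \<open>R\<close> solves for column \<open>J\<close> of the
  averaging projection. Hence \<open>H R\<close> is that projection and fixes every symmetric
  \<open>Z\<close>.\<close>

lemma positive_definite_inverse:
  assumes X: "finite X" "rank_closed X" and H: "symmetric_hermitian X H" "positive_definite_on X H"
  obtains R where "\<And>J. (\<lambda>K. R K J) \<in> states X"
    and "\<And>Z I. symmetric_on X Z \<Longrightarrow> I \<in> X \<Longrightarrow> (\<Sum>K\<in>X. H I K * (\<Sum>J\<in>X. R K J * Z J)) = Z I"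
proof -
  define b where "b J I = (of_bool (idx_class J = idx_class I) / of_nat (card {y\<in>X. idx_class y = idx_class I}) :: complex)" for J I
  have "\<exists>t. t \<in> states X \<and> (\<forall>I\<in>X. (\<Sum>K\<in>X. H I K * t K) = b J I)" for J
  proof -
    have "symmetric_on X (b J)"
      by (auto simp: symmetric_on_iff[OF X(2)] b_def)
    then show ?thesis
      using positive_definite_solvable[OF X H] by metis
  qed
  then obtain R where R: "\<And>J. R J \<in> states X" "\<And>J I. I \<in> X \<Longrightarrow> (\<Sum>K\<in>X. H I K * R J K) = b J I"
    by metis
  show ?thesis
  proof
    show "(\<lambda>K. R J K) \<in> states X" for J using R(1) .
    fix Z I assume Z: "symmetric_on X Z" and I: "I \<in> X"
    have "(\<Sum>K\<in>X. H I K * (\<Sum>J\<in>X. R J K * Z J)) = (\<Sum>J\<in>X. (\<Sum>K\<in>X. H I K * R J K) * Z J)"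
      unfolding sum_distrib_left sum_distrib_right by (subst sum.swap) (simp add: mult.assoc)
    also have "\<dots> = (\<Sum>J\<in>X. b J I * Z J)"
      using R(2)[OF I] by simp
    also have "\<dots> = class_avg X idx_class Z I"
      using X(1) by (simp add: class_avg_def b_def sum.inter_filter sum_divide_distrib of_bool_def
          if_distrib[of "\<lambda>a. a * _"] if_distrib[of "\<lambda>a. a / _"] cong: if_cong)
    also have "\<dots> = Z I"
      by (rule class_avg_invariant[OF X(1) I], rule Z[unfolded symmetric_on_iff[OF X(2)], rule_format, OF I])
    finally show "(\<Sum>K\<in>X. H I K * (\<Sum>J\<in>X. R J K * Z J)) = Z I" .
  qed
qed

section \<open>Index sets of the variables and sums over them\<close>

lemma finite_idx_set:
  fixes N :: nat and n :: "nat \<Rightarrow> nat"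
  shows "finite {(\<mu>, ii :: 3 list, a). \<mu> < N \<and> length ii \<le> l \<mu> \<and> a < n \<mu>}"
proof (rule finite_subset)
  show "{(\<mu>, ii :: 3 list, a). \<mu> < N \<and> length ii \<le> l \<mu> \<and> a < n \<mu>}
      \<subseteq> (\<Union>\<mu><N. {\<mu>} \<times> (\<Union>k\<le>l \<mu>. tuples k) \<times> {..<n \<mu>})"
    by (auto simp: tuples_def)
qed (intro finite_UN_I finite_cartesian_product; simp)

lemma finite_red_idx [simp]: "finite (red_idx sys)"
  unfolding red_idx_def by (rule finite_idx_set)

lemma top_subset_red: "top_idx sys \<subseteq> red_idx sys"
  by (auto simp: top_idx_def red_idx_def)

lemma finite_top_idx [simp]: "finite (top_idx sys)"
  using finite_subset[OF top_subset_red] by simp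

lemma rank_closed_top: "rank_closed (top_idx sys)"
  and rank_closed_red: "rank_closed (red_idx sys)"
  by (auto simp: rank_closed_def top_idx_def red_idx_def)

text \<open>Extension by zero keeps a state symmetric because a class lies inside
  \<open>top_idx\<close> or misses it.\<close>

lemma states_top_subset_red: "states (top_idx sys) \<subseteq> states (red_idx sys)"
proof
  fix u assume u: "u \<in> states (top_idx sys)"
  have "u J = u I" if "I \<in> red_idx sys" "idx_class J = idx_class I" for I J
  proof (cases "I \<in> top_idx sys")
    case True
    then show ?thesis
      using u that unfolding states_def symmetric_on_iff[OF rank_closed_top] by blast
  next
    case False
    moreover have "J \<notin> top_idx sys"
      using False rank_closed_idx_class[OF rank_closed_top, of J sys I] that by auto
    ultimately show ?thesis
      using u by (simp add: states_def del: split_paired_All)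
  qed
  then show "u \<in> states (red_idx sys)"
    using u top_subset_red unfolding states_def symmetric_on_iff[OF rank_closed_red] by blast
qed

lemma sum_top_idx:
  "(\<Sum>K\<in>top_idx sys. F K)
    = (\<Sum>\<nu><sys_order sys. \<Sum>jj\<in>tuples (sys_order sys - \<nu> - 1). \<Sum>b<ncomp sys \<nu>. F (\<nu>, jj, b))"
proof -
  have "top_idx sys = Sigma {..<sys_order sys} (\<lambda>\<nu>. tuples (sys_order sys - \<nu> - 1) \<times> {..<ncomp sys \<nu>})"
    by (auto simp: top_idx_def tuples_def)
  then show ?thesis
    by (simp add: sum.Sigma split_beta sum.cartesian_product)
qed

lemma sum_tuples_Suc: "(\<Sum>kk\<in>tuples (Suc r). F kk) = (\<Sum>p\<in>UNIV. \<Sum>jj\<in>tuples r. F (p # jj))"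
proof -
  have "(\<Sum>p\<in>UNIV. \<Sum>jj\<in>tuples r. F (p # jj)) = (\<Sum>(p, jj)\<in>UNIV \<times> tuples r. F (p # jj))"
    by (rule sum.cartesian_product)
  also have "\<dots> = (\<Sum>kk\<in>tuples (Suc r). F kk)"
    by (rule sum.reindex_bij_witness[where i="\<lambda>kk. (hd kk, tl kk)" and j="\<lambda>(p, jj). p # jj"])
      (auto simp: tuples_def length_Suc_conv)
  finally show ?thesis ..
qed

section \<open>The principal symbols\<close>

text \<open>Displays symmetrization as a matrix, so that coefficients of individual derivatives can
  be read off.\<close>

lemma symmetrize_kernel:
  "symmetrize f xs = (\<Sum>kk\<in>tuples (length xs). symmetrize (\<lambda>ys. of_bool (ys = kk)) xs * f kk)"
proof -
  have "(\<Sum>kk\<in>tuples (length xs). symmetrize (\<lambda>ys. of_bool (ys = kk)) xs * f kk)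
      = symmetrize (\<lambda>ys. \<Sum>kk\<in>tuples (length xs). f kk * of_bool (ys = kk)) xs"
    by (simp only: symmetrize_sum symmetrize_mult_left mult.commute)
  also have "\<dots> = symmetrize f xs"
  proof (rule symmetrize_cong)
    fix ys assume "mset ys = mset xs"
    then have "ys \<in> tuples (length xs)"
      by (auto simp: tuples_def dest: mset_eq_length)
    then show "(\<Sum>kk\<in>tuples (length xs). f kk * of_bool (ys = kk)) = f ys"
      by (simp add: of_bool_def if_distrib[of "\<lambda>a. _ * a"] cong: if_cong)
  qed
  finally show ?thesis ..
qed

lemma s_prod_cong_mset: "mset xs = mset ys \<Longrightarrow> s_prod s xs = s_prod s ys"
  unfolding s_prod_def by (metis mset_map prod_mset_prod_list)

lemma s_prod_Cons: "s_prod s (p # jj) = of_real (s $ p) * s_prod s jj"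
  by (simp add: s_prod_def)

lemma symmetrize_s_prod: "symmetrize (s_prod s) xs = s_prod s xs"
  by (rule symmetrize_invariant) (rule s_prod_cong_mset)

text \<open>The coefficient of the derivative in direction \<open>hd kk\<close> of the entry \<open>tl kk\<close> of \<open>d\<^sup>\<nu>\<close> (component \<open>b\<close>)
  in a top-rank equation without constraint addition.\<close>

fun A_kernel :: "ftns_system \<Rightarrow> idx \<Rightarrow> idx \<Rightarrow> complex" where
  "A_kernel sys (\<mu>, ii, a) (\<nu>, kk, b) =
     (if \<nu> \<le> \<mu> + 1 then \<Sum>jj\<in>tuples (\<mu> + 1 - \<nu>). coefA sys \<mu> \<nu> jj a b *
        (if \<mu> + 2 \<le> sys_order sys then symmetrize (\<lambda>ys. of_bool (ys = kk)) (ii @ jj) else of_bool (jj = kk))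
      else 0)"

text \<open>One form for both top-rank cases of \<open>A_terms\<close>. The list \<open>kk\<close>
  consists of the derivative direction and the indices of the highest \<open>d^\<nu>\<close>, hence
  its length \<open>N - \<nu>\<close>. Only the equation for \<open>v^(N-1)\<close> comes without
  symmetrization.\<close>

lemma A_terms_eq_kernel:
  assumes "I \<in> top_idx sys"
  shows "A_terms sys (\<lambda>_. 0) du I = (\<Sum>\<nu><sys_order sys. \<Sum>kk\<in>tuples (sys_order sys - \<nu>). \<Sum>b<ncomp sys \<nu>.
    A_kernel sys I (\<nu>, kk, b) * grad du \<nu> b kk)"
proof -
  let ?N = "sys_order sys"
  obtain \<mu> ii a where I: "I = (\<mu>, ii, a)" "\<mu> < ?N" "length ii = ?N - \<mu> - 1"
    using assms by (auto simp: top_idx_def)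
  define E where "E \<nu> b jj = (if \<mu> + 2 \<le> ?N then symmetrize (grad du \<nu> b) (ii @ jj) else grad du \<nu> b jj)" for \<nu> b jj
  define e where "e \<nu> = (\<Sum>jj\<in>tuples (\<mu> + 1 - \<nu>). \<Sum>b<ncomp sys \<nu>. coefA sys \<mu> \<nu> jj a b * E \<nu> b jj)" for \<nu>
  have "A_terms sys (\<lambda>_. 0) du I = (\<Sum>\<nu><?N. if \<nu> \<le> \<mu> + 1 then e \<nu> else 0)"
  proof (cases "\<mu> + 2 \<le> ?N")
    case True
    then have "{\<nu> \<in> {..<?N}. \<nu> \<le> \<mu> + 1} = {0..\<mu> + 1}" by auto
    then have "(\<Sum>\<nu><?N. if \<nu> \<le> \<mu> + 1 then e \<nu> else 0) = (\<Sum>\<nu>\<in>{0..\<mu> + 1}. e \<nu>)"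
      using sum.inter_filter[of "{..<?N}" e "\<lambda>\<nu>. \<nu> \<le> \<mu> + 1"] by simp
    moreover have "\<not> \<mu> + length ii + 2 \<le> ?N"
      using True I by simp
    ultimately show ?thesis
      using True by (simp only: I A_terms.simps e_def E_def if_True if_False)
  next
    case False
    then have N: "?N = Suc \<mu>" using I by simp
    have "e \<nu> = (\<Sum>j\<in>UNIV. \<Sum>jj\<in>tuples (\<mu> - \<nu>). \<Sum>b<ncomp sys \<nu>. coefA sys \<mu> \<nu> (j # jj) a b * du j (\<nu>, jj, b))"
      if "\<nu> \<le> \<mu>" for \<nu>
      using False that by (simp add: e_def E_def Suc_diff_le sum_tuples_Suc grad_def)
    then show ?thesis
      using False I N by (simp add: lessThan_Suc_atMost atMost_atLeast0)
  qed
  also have "\<dots> = (\<Sum>\<nu><?N. \<Sum>kk\<in>tuples (?N - \<nu>). \<Sum>b<ncomp sys \<nu>. A_kernel sys I (\<nu>, kk, b) * grad du \<nu> b kk)"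
  proof (rule sum.cong[OF refl])
    fix \<nu> assume \<nu>: "\<nu> \<in> {..<?N}"
    let ?ker = "\<lambda>jj kk. if \<mu> + 2 \<le> ?N then symmetrize (\<lambda>ys. of_bool (ys = kk)) (ii @ jj) else of_bool (jj = kk)"
    show "(if \<nu> \<le> \<mu> + 1 then e \<nu> else 0)
        = (\<Sum>kk\<in>tuples (?N - \<nu>). \<Sum>b<ncomp sys \<nu>. A_kernel sys I (\<nu>, kk, b) * grad du \<nu> b kk)"
    proof (cases "\<nu> \<le> \<mu> + 1")
      case True
      have E: "E \<nu> b jj = (\<Sum>kk\<in>tuples (?N - \<nu>). ?ker jj kk * grad du \<nu> b kk)"
        if jj: "jj \<in> tuples (\<mu> + 1 - \<nu>)" for b jj
      proof (cases "\<mu> + 2 \<le> ?N")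
        case c: True
        have "length (ii @ jj) = ?N - \<nu>"
          using jj I True by (simp add: tuples_def)
        then show ?thesis
          using c symmetrize_kernel[of "grad du \<nu> b" "ii @ jj"] by (simp add: E_def)
      next
        case False
        then have "jj \<in> tuples (?N - \<nu>)"
          using jj I True \<nu> by (simp add: tuples_def)
        then show ?thesis
          using False by (simp add: E_def of_bool_def if_distrib[of "\<lambda>a. a * _"] cong: if_cong)
      qed
      have "e \<nu> = (\<Sum>jj\<in>tuples (\<mu> + 1 - \<nu>). \<Sum>b<ncomp sys \<nu>. \<Sum>kk\<in>tuples (?N - \<nu>).
          coefA sys \<mu> \<nu> jj a b * ?ker jj kk * grad du \<nu> b kk)"
        unfolding e_def by (intro sum.cong refl) (simp only: E sum_distrib_left mult.assoc)
      also have "\<dots> = (\<Sum>kk\<in>tuples (?N - \<nu>). \<Sum>b<ncomp sys \<nu>. \<Sum>jj\<in>tuples (\<mu> + 1 - \<nu>).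
          coefA sys \<mu> \<nu> jj a b * ?ker jj kk * grad du \<nu> b kk)"
        unfolding sum.swap[of _ "{..<ncomp sys \<nu>}" "tuples (?N - \<nu>)"]
        by (subst sum.swap) (intro sum.cong refl sum.swap)
      also have "\<dots> = (\<Sum>kk\<in>tuples (?N - \<nu>). \<Sum>b<ncomp sys \<nu>. A_kernel sys I (\<nu>, kk, b) * grad du \<nu> b kk)"
        using True by (simp only: I A_kernel.simps if_True sum_distrib_right)
      finally show ?thesis using True by simp
    qed (simp add: I)
  qed
  finally show ?thesis .
qed

text \<open>The indices in \<open>tl kk\<close> belong to a symmetric tensor, so only this part of
  the kernel acts. The tail symmetry is also what admissible parameters require; the direction
  \<open>hd kk\<close> stays separate.\<close>

fun top_coef :: "ftns_system \<Rightarrow> idx \<Rightarrow> idx \<Rightarrow> complex" where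
  "top_coef sys I (\<nu>, kk, b) = symmetrize (\<lambda>jj. A_kernel sys I (\<nu>, hd kk # jj, b)) (tl kk)"

text \<open>Symmetrization moves from the coefficients to \<open>w\<close>, which is symmetric
  already.\<close>

lemma sum_tail_symmetrize:
  assumes "\<And>xs ys. xs \<in> tuples r \<Longrightarrow> mset ys = mset xs \<Longrightarrow> w ys = w xs"
  shows "(\<Sum>kk\<in>tuples (Suc r). symmetrize (\<lambda>jj. X (hd kk # jj)) (tl kk) * (c (hd kk) * w (tl kk)))
    = (\<Sum>kk\<in>tuples (Suc r). X kk * (c (hd kk) * w (tl kk)))"
proof -
  have w: "symmetrize w jj = w jj" if "jj \<in> tuples r" for jj
    by (rule symmetrize_invariant) (rule assms[OF that])
  have "(\<Sum>jj\<in>tuples r. symmetrize (\<lambda>jj. X (p # jj)) jj * (c p * w jj))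
      = (\<Sum>jj\<in>tuples r. X (p # jj) * (c p * w jj))" for p
  proof -
    have "(\<Sum>jj\<in>tuples r. symmetrize (\<lambda>jj. X (p # jj)) jj * (c p * w jj))
        = c p * (\<Sum>jj\<in>tuples r. symmetrize (\<lambda>jj. X (p # jj)) jj * w jj)"
      by (simp add: sum_distrib_left mult.left_commute)
    also have "\<dots> = c p * (\<Sum>jj\<in>tuples r. X (p # jj) * w jj)"
      by (simp add: sum_symmetrize w cong: sum.cong)
    finally show ?thesis
      by (simp add: sum_distrib_left mult.left_commute)
  qed
  then show ?thesis
    by (simp add: sum_tuples_Suc)
qed

text \<open>Powers of \<open>s\<close> are symmetric, so both symmetrizations can be moved onto them
  and dropped; the Kronecker symbols then identify \<open>p # jj\<close> with
  \<open>ii @ kk\<close>.\<close>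

lemma Delta_sym_contracted:
  assumes "length ii + length kk = Suc r"
  shows "(\<Sum>p\<in>UNIV. \<Sum>jj\<in>tuples r. Delta_sym p jj ii kk * (of_real (s $ p) * s_prod s jj))
    = s_prod s ii * s_prod s kk"
proof -
  define F where "F p jj = symmetrize (\<lambda>ii'. of_bool (p # jj = ii' @ kk)) ii" for p jj
  have "(\<Sum>p\<in>UNIV. \<Sum>jj\<in>tuples r. Delta_sym p jj ii kk * (of_real (s $ p) * s_prod s jj))
      = (\<Sum>p\<in>UNIV. of_real (s $ p) * (\<Sum>jj\<in>tuples r. symmetrize (F p) jj * s_prod s jj))"
    by (simp add: Delta_sym_def F_def[abs_def] sum_distrib_left mult.left_commute)
  also have "\<dots> = (\<Sum>p\<in>UNIV. \<Sum>jj\<in>tuples r. s_prod s (p # jj) * F p jj)"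
    unfolding sum_symmetrize symmetrize_s_prod
    by (simp add: sum_distrib_left s_prod_Cons mult.assoc mult.commute mult.left_commute)
  also have "\<dots> = symmetrize (\<lambda>ii'. \<Sum>p\<in>UNIV. \<Sum>jj\<in>tuples r. s_prod s (p # jj) * of_bool (p # jj = ii' @ kk)) ii"
    by (simp only: F_def symmetrize_sum symmetrize_mult_left)
  also have "\<dots> = symmetrize (\<lambda>ii'. s_prod s kk * s_prod s ii') ii"
  proof (rule symmetrize_cong)
    fix ii' assume "mset ii' = mset ii"
    then have "ii' @ kk \<in> tuples (Suc r)"
      using assms by (auto simp: tuples_def dest: mset_eq_length)
    then have "(\<Sum>ll\<in>tuples (Suc r). s_prod s ll * of_bool (ll = ii' @ kk)) = s_prod s (ii' @ kk)"
      by (simp add: of_bool_def if_distrib[of "\<lambda>a. _ * a"] cong: if_cong)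
    then show "(\<Sum>p\<in>UNIV. \<Sum>jj\<in>tuples r. s_prod s (p # jj) * of_bool (p # jj = ii' @ kk)) = s_prod s kk * s_prod s ii'"
      by (simp add: sum_tuples_Suc s_prod_append mult.commute)
  qed
  also have "\<dots> = s_prod s ii * s_prod s kk"
    by (simp add: symmetrize_mult_left symmetrize_s_prod)
  finally show ?thesis .
qed

text \<open>The kernel of the reduction and the FTNS principal matrix symmetrize over different
  groups of indices. Contraction with powers of \<open>s\<close> removes the difference.\<close>

lemma top_coef_contracted:
  assumes I: "I \<in> top_idx sys" and \<nu>: "\<nu> < sys_order sys"
  shows "(\<Sum>kk\<in>tuples (sys_order sys - \<nu>). top_coef sys I (\<nu>, kk, b) * s_prod s kk)
    = (\<Sum>p\<in>UNIV. \<Sum>jj\<in>tuples (sys_order sys - \<nu> - 1). principal_N sys p I (\<nu>, jj, b) * of_real (s $ p) * s_prod s jj)"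
proof -
  let ?N = "sys_order sys"
  obtain \<mu> ii a where I': "I = (\<mu>, ii, a)" "\<mu> < ?N" "length ii = ?N - \<mu> - 1"
    using I by (auto simp: top_idx_def)
  define r where "r = ?N - \<nu> - 1"
  have r: "?N - \<nu> = Suc r" using \<nu> by (simp add: r_def)
  have hdtl: "s_prod s kk = of_real (s $ hd kk) * s_prod s (tl kk)" if "kk \<in> tuples (Suc r)" for kk
    using that by (cases kk) (auto simp: tuples_def s_prod_Cons)
  have "(\<Sum>kk\<in>tuples (Suc r). top_coef sys I (\<nu>, kk, b) * s_prod s kk)
      = (\<Sum>kk\<in>tuples (Suc r). symmetrize (\<lambda>jj. A_kernel sys I (\<nu>, hd kk # jj, b)) (tl kk)
          * (of_real (s $ hd kk) * s_prod s (tl kk)))"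
    by (intro sum.cong refl) (simp only: hdtl top_coef.simps)
  also have "\<dots> = (\<Sum>kk\<in>tuples (Suc r). A_kernel sys I (\<nu>, kk, b) * (of_real (s $ hd kk) * s_prod s (tl kk)))"
    by (rule sum_tail_symmetrize[where X="\<lambda>kk. A_kernel sys I (\<nu>, kk, b)" and c="\<lambda>p. of_real (s $ p)"])
      (rule s_prod_cong_mset)
  also have "\<dots> = (\<Sum>kk\<in>tuples (Suc r). A_kernel sys I (\<nu>, kk, b) * s_prod s kk)"
    by (intro sum.cong refl) (simp only: hdtl)
  also have "\<dots> = (\<Sum>p\<in>UNIV. \<Sum>jj\<in>tuples r. principal_N sys p I (\<nu>, jj, b) * of_real (s $ p) * s_prod s jj)"
  proof (cases "\<nu> \<le> \<mu> + 1")
    case True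
    let ?ker = "\<lambda>jj kk. if \<mu> + 2 \<le> ?N then symmetrize (\<lambda>ys. of_bool (ys = kk)) (ii @ jj) else of_bool (jj = kk)"
    let ?k = "tuples (\<mu> + 1 - \<nu>)"
    have len: "length ii + length jj = Suc r" if "jj \<in> ?k" for jj
      using that True I' r by (auto simp: tuples_def)
    have ker: "(\<Sum>kk\<in>tuples (Suc r). ?ker jj kk * s_prod s kk) = s_prod s ii * s_prod s jj" if jj: "jj \<in> ?k" for jj
    proof (cases "\<mu> + 2 \<le> ?N")
      case c: True
      then show ?thesis
        using symmetrize_kernel[of "s_prod s" "ii @ jj"] len[OF jj]
        by (simp add: symmetrize_s_prod s_prod_append)
    next
      case False
      then have "ii = []" "jj \<in> tuples (Suc r)"
        using I' len[OF jj] by (auto simp: tuples_def)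
      then show ?thesis
        using False by (simp add: of_bool_def if_distrib[of "\<lambda>a. a * _"] s_prod_def cong: if_cong)
    qed
    have "(\<Sum>kk\<in>tuples (Suc r). A_kernel sys I (\<nu>, kk, b) * s_prod s kk)
        = (\<Sum>jj\<in>?k. coefA sys \<mu> \<nu> jj a b * (\<Sum>kk\<in>tuples (Suc r). ?ker jj kk * s_prod s kk))"
      using True unfolding I' A_kernel.simps if_P[OF True] sum_distrib_right sum_distrib_left
      by (subst sum.swap) (simp only: mult.assoc)
    also have "\<dots> = (\<Sum>jj\<in>?k. coefA sys \<mu> \<nu> jj a b *
        (\<Sum>p\<in>UNIV. \<Sum>ll\<in>tuples r. Delta_sym p ll ii jj * (of_real (s $ p) * s_prod s ll)))"
      by (rule sum.cong[OF refl]) (simp only: ker Delta_sym_contracted[OF len])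
    also have "\<dots> = (\<Sum>p\<in>UNIV. \<Sum>ll\<in>tuples r. \<Sum>jj\<in>?k.
        Delta_sym p ll ii jj * coefA sys \<mu> \<nu> jj a b * of_real (s $ p) * s_prod s ll)"
      unfolding sum_distrib_left
      by (subst sum.swap, rule sum.cong[OF refl], subst sum.swap, intro sum.cong refl)
        (simp only: mult.assoc mult.commute mult.left_commute)
    also have "\<dots> = (\<Sum>p\<in>UNIV. \<Sum>jj\<in>tuples r. principal_N sys p I (\<nu>, jj, b) * of_real (s $ p) * s_prod s jj)"
      using True by (simp only: I' principal_N.simps if_True sum_distrib_right)
    finally show ?thesis .
  qed (simp add: I')
  finally show ?thesis by (simp only: r diff_Suc_1)
qed

section \<open>The first order symbol on plane-wave gradients\<close>

definition plane_grad :: "real^3 \<Rightarrow> state \<Rightarrow> 3 \<Rightarrow> state" where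
  "plane_grad s w = (\<lambda>p J. of_real (s $ p) * w J)"

lemma grad_plane_grad: "grad (plane_grad s w) \<nu> b kk = of_real (s $ hd kk) * w (\<nu>, tl kk, b)"
  by (simp add: grad_def plane_grad_def)

lemma linear_functional_sum:
  fixes L :: "(3 \<Rightarrow> state) \<Rightarrow> complex"
  assumes "\<And>d e. L (\<lambda>q J. d q J + e q J) = L d + L e"
    and "\<And>c d. L (\<lambda>q J. c * d q J) = c * L d"
    and "finite P"
  shows "L (\<lambda>q J. \<Sum>p\<in>P. c p * D p q J) = (\<Sum>p\<in>P. c p * L (D p))"
  using assms(3)
proof (induction P rule: finite_induct)
  case empty
  then show ?case using assms(2)[of 0 "\<lambda>_ _. 0"] by simp
next
  case (insert p P)
  then show ?case by (simp add: assms(1) assms(2))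
qed

lemma grad_add: "grad (\<lambda>q J. d q J + e q J) \<nu> b = (\<lambda>kk. grad d \<nu> b kk + grad e \<nu> b kk)"
  and grad_mult: "grad (\<lambda>q J. c * d q J) \<nu> b = (\<lambda>kk. c * grad d \<nu> b kk)"
  by (auto simp: grad_def)

lemma A_terms_add:
  "A_terms sys (\<lambda>_. 0) (\<lambda>q J. d q J + e q J) I = A_terms sys (\<lambda>_. 0) d I + A_terms sys (\<lambda>_. 0) e I"
  by (cases I) (simp add: grad_add symmetrize_add distrib_left sum.distrib)

lemma A_terms_mult: "A_terms sys (\<lambda>_. 0) (\<lambda>q J. c * d q J) I = c * A_terms sys (\<lambda>_. 0) d I"
  by (cases I) (simp add: grad_mult symmetrize_mult_left mult.left_commute flip: sum_distrib_left)

lemma constraint_addition_add: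
  "constraint_addition sys r (\<lambda>_. 0) (\<lambda>q J. d q J + e q J) I
    = constraint_addition sys r (\<lambda>_. 0) d I + constraint_addition sys r (\<lambda>_. 0) e I"
  by (simp add: constraint_addition_def constr_def constr_bar_def grad_add symmetrize_add
      distrib_left right_diff_distrib sum.distrib sum_subtractf)

lemma constraint_addition_mult:
  "constraint_addition sys r (\<lambda>_. 0) (\<lambda>q J. c * d q J) I = c * constraint_addition sys r (\<lambda>_. 0) d I"
  by (simp add: constraint_addition_def constr_def constr_bar_def grad_mult symmetrize_mult_left
      mult.left_commute flip: sum_distrib_left distrib_left right_diff_distrib)

text \<open>\<open>principal_1\<close> treats one derivative direction at a time; by linearity in
  the gradient, the symbol results from inserting the gradient of a plane wave once.\<close>

lemma symbol_1_eq:
  "symbol_1 sys r s w I = (if I \<in> red_idx sys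
    then A_terms sys (\<lambda>_. 0) (plane_grad s w) I + constraint_addition sys r (\<lambda>_. 0) (plane_grad s w) I
    else 0)"
proof -
  let ?D = "\<lambda>p q. if q = p then w else (\<lambda>_. 0)"
  have B: "B_terms sys (\<lambda>_. 0) I = 0"
    by (cases I) simp
  have pg: "plane_grad s w = (\<lambda>q J. \<Sum>p\<in>UNIV. of_real (s $ p) * ?D p q J)"
    by (intro ext) (simp add: plane_grad_def if_distribR if_distrib[of "\<lambda>a. _ * a"] cong: if_cong)
  have "A_terms sys (\<lambda>_. 0) (plane_grad s w) I = (\<Sum>p\<in>UNIV. of_real (s $ p) * A_terms sys (\<lambda>_. 0) (?D p) I)"
    unfolding pg by (rule linear_functional_sum) (auto simp: A_terms_add A_terms_mult)
  moreover have "constraint_addition sys r (\<lambda>_. 0) (plane_grad s w) I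
      = (\<Sum>p\<in>UNIV. of_real (s $ p) * constraint_addition sys r (\<lambda>_. 0) (?D p) I)"
    unfolding pg by (rule linear_functional_sum) (auto simp: constraint_addition_add constraint_addition_mult)
  ultimately show ?thesis
    by (simp add: symbol_1_def principal_1_def reduction_rhs_def B distrib_left sum.distrib)
qed

text \<open>In the lower-rank equations the derivatives have been replaced by variables, so the
  \<open>A\<close> terms contain no gradient.\<close>

lemma A_terms_lower:
  assumes "I \<in> red_idx sys" "I \<notin> top_idx sys"
  shows "A_terms sys (\<lambda>_. 0) du I = 0"
  using assms by (cases I) (auto simp: red_idx_def top_idx_def)

text \<open>Symmetry of \<open>w\<close> allows the kernel to be replaced by its tail-symmetrized
  version \<open>top_coef\<close>.\<close>

lemma A_terms_plane_grad:
  assumes I: "I \<in> top_idx sys" and w: "symmetric_on (top_idx sys) w"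
  shows "A_terms sys (\<lambda>_. 0) (plane_grad s w) I = (\<Sum>\<nu><sys_order sys. \<Sum>kk\<in>tuples (sys_order sys - \<nu>).
    \<Sum>b<ncomp sys \<nu>. top_coef sys I (\<nu>, kk, b) * (of_real (s $ hd kk) * w (\<nu>, tl kk, b)))"
  unfolding A_terms_eq_kernel[OF I] grad_plane_grad
proof (rule sum.cong[OF refl])
  fix \<nu> assume \<nu>: "\<nu> \<in> {..<sys_order sys}"
  define r where "r = sys_order sys - \<nu> - 1"
  have r: "sys_order sys - \<nu> = Suc r" using \<nu> by (simp add: r_def)
  have "(\<Sum>kk\<in>tuples (Suc r). top_coef sys I (\<nu>, kk, b) * (of_real (s $ hd kk) * w (\<nu>, tl kk, b)))
      = (\<Sum>kk\<in>tuples (Suc r). A_kernel sys I (\<nu>, kk, b) * (of_real (s $ hd kk) * w (\<nu>, tl kk, b)))"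
    if b: "b < ncomp sys \<nu>" for b
    unfolding top_coef.simps
  proof (rule sum_tail_symmetrize)
    fix xs ys :: "3 list" assume xs: "xs \<in> tuples r" and ys: "mset ys = mset xs"
    have "(\<nu>, xs, b) \<in> top_idx sys"
      using \<nu> b xs by (auto simp: top_idx_def tuples_def r_def)
    from w[unfolded symmetric_on_iff[OF rank_closed_top], rule_format, OF this, of "(\<nu>, ys, b)"]
    show "w (\<nu>, ys, b) = w (\<nu>, xs, b)"
      using ys by simp
  qed
  then show "(\<Sum>kk\<in>tuples (sys_order sys - \<nu>). \<Sum>b<ncomp sys \<nu>.
        A_kernel sys I (\<nu>, kk, b) * (of_real (s $ hd kk) * w (\<nu>, tl kk, b)))
      = (\<Sum>kk\<in>tuples (sys_order sys - \<nu>). \<Sum>b<ncomp sys \<nu>.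
        top_coef sys I (\<nu>, kk, b) * (of_real (s $ hd kk) * w (\<nu>, tl kk, b)))"
    unfolding r sum.swap[of _ "{..<ncomp sys \<nu>}" "tuples (Suc r)"] by simp
qed

section \<open>From first order to FTNS symmetrizers\<close>

lemma sesq_supported:
  assumes "finite X" "Y \<subseteq> X" "\<And>I. I \<in> X - Y \<Longrightarrow> u I = 0" "\<And>I. I \<in> X - Y \<Longrightarrow> w I = 0"
  shows "sesq X H u w = sesq Y H u w"
proof -
  have "sesq X H u w = (\<Sum>I\<in>Y. \<Sum>J\<in>X. cnj (u I) * H I J * w J)"
    unfolding sesq_def by (rule sum.mono_neutral_right) (use assms in auto)
  also have "\<dots> = sesq Y H u w"
    unfolding sesq_def by (intro sum.cong refl sum.mono_neutral_right) (use assms in auto)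
  finally show ?thesis .
qed

text \<open>The column of the matrix \<open>S^N\<close> that belongs to component \<open>a\<close>
  of \<open>v^\<mu>\<close>, read as a state that vanishes on lower ranks.\<close>

definition wave :: "ftns_system \<Rightarrow> real^3 \<Rightarrow> nat \<Rightarrow> nat \<Rightarrow> state" where
  "wave sys s \<mu> a = (\<lambda>(\<kappa>, ii, c).
     if \<kappa> = \<mu> \<and> c = a \<and> length ii = sys_order sys - \<mu> - 1 then s_prod s ii else 0)"

lemma wave_in_states:
  assumes "\<mu> < sys_order sys" "a < ncomp sys \<mu>"
  shows "wave sys s \<mu> a \<in> states (top_idx sys)"
  unfolding states_def mem_Collect_eq symmetric_on_iff[OF rank_closed_top]
proof (intro conjI ballI allI impI)
  fix I J assume "I \<in> top_idx sys" "idx_class J = idx_class I"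
  then obtain \<kappa> ii jj c where "I = (\<kappa>, ii, c)" "J = (\<kappa>, jj, c)" "mset jj = mset ii"
    by (cases I; cases J) auto
  then show "wave sys s \<mu> a J = wave sys s \<mu> a I"
    using s_prod_cong_mset[of jj ii s] mset_eq_length[of jj ii] by (simp add: wave_def)
next
  fix I assume "I \<notin> top_idx sys"
  then show "wave sys s \<mu> a I = 0"
    using assms by (cases I) (auto simp: wave_def top_idx_def)
qed

lemma grad_wave:
  assumes "\<mu> < sys_order sys" "kk \<noteq> []"
  shows "grad (plane_grad s (wave sys s \<mu> a)) \<nu> b kk
    = (if \<nu> = \<mu> \<and> b = a \<and> length kk = sys_order sys - \<mu> then s_prod s kk else 0)"
  using assms by (cases kk) (auto simp: grad_plane_grad wave_def s_prod_Cons)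

lemma symmetrize_grad_wave:
  assumes "\<mu> < sys_order sys" "kk \<noteq> []"
  shows "symmetrize (grad (plane_grad s (wave sys s \<mu> a)) \<nu> b) kk = grad (plane_grad s (wave sys s \<mu> a)) \<nu> b kk"
proof (rule symmetrize_invariant)
  fix ys assume ys: "mset ys = mset kk"
  then have "ys \<noteq> []" using assms by auto
  then show "grad (plane_grad s (wave sys s \<mu> a)) \<nu> b ys = grad (plane_grad s (wave sys s \<mu> a)) \<nu> b kk"
    unfolding grad_wave[OF assms(1) \<open>ys \<noteq> []\<close>] grad_wave[OF assms]
    by (simp add: s_prod_cong_mset[OF ys] mset_eq_length[OF ys])
qed

text \<open>At \<open>u = 0\<close>, \<open>constr\<close> involves only gradients of variables
  below top rank, where the wave vanishes. The gradient of the wave is a power of \<open>s\<close>,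
  hence totally symmetric and invisible to \<open>constr_bar\<close>.\<close>

lemma constraint_addition_wave:
  assumes "\<mu> < sys_order sys"
  shows "constraint_addition sys r (\<lambda>_. 0) (plane_grad s (wave sys s \<mu> a)) I = 0"
proof -
  let ?du = "plane_grad s (wave sys s \<mu> a)"
  have "constr (\<lambda>_. 0) ?du \<nu> kk b = 0"
    if "\<sigma> \<in> {1..sys_order sys - \<nu> - 1}" "kk \<in> tuples \<sigma>" for \<nu> \<sigma> b kk
  proof -
    \<comment> \<open>The label \<sigma> is at most \<open>N - \<nu> - 1\<close>, one less than the
      length at which the wave can have a gradient.\<close>
    have "kk \<noteq> []" "length kk \<noteq> sys_order sys - \<nu>"
      using that by (auto simp: tuples_def)
    then show ?thesis
      by (auto simp: constr_def symmetrize_grad_wave[OF assms] grad_wave[OF assms])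
  qed
  moreover have "constr_bar ?du \<nu> kk b = 0" if "kk \<in> tuples (\<sigma> + 1)" for \<nu> \<sigma> b kk
  proof -
    have "kk \<noteq> []" using that by (auto simp: tuples_def)
    then show ?thesis
      by (simp add: constr_bar_def symmetrize_grad_wave[OF assms])
  qed
  ultimately show ?thesis
    unfolding constraint_addition_def by (intro sum.neutral ballI) simp
qed

lemma sum_top_wave:
  assumes "\<mu> < sys_order sys" "a < ncomp sys \<mu>"
  shows "(\<Sum>I\<in>top_idx sys. wave sys s \<mu> a I * Y I)
    = (\<Sum>ii\<in>tuples (sys_order sys - \<mu> - 1). s_prod s ii * Y (\<mu>, ii, a))"
proof -
  have "(\<Sum>I\<in>top_idx sys. wave sys s \<mu> a I * Y I)
      = (\<Sum>\<kappa><sys_order sys. if \<kappa> = \<mu> then \<Sum>ii\<in>tuples (sys_order sys - \<kappa> - 1). \<Sum>c<ncomp sys \<kappa>.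
          if c = a then s_prod s ii * Y (\<kappa>, ii, c) else 0 else 0)"
    unfolding sum_top_idx by (rule sum.cong[OF refl]) (auto simp: wave_def tuples_def if_distrib[of "\<lambda>x. x * _"] cong: if_cong intro!: sum.cong)
  then show ?thesis using assms by simp
qed

text \<open>The parameters \<open>r\<close> drop out because constraint additions vanish on waves;
  what is left of the \<open>A\<close> terms is given by \<open>top_coef_contracted\<close>.\<close>

lemma symbol_1_wave:
  assumes \<nu>: "\<nu> < sys_order sys" "b < ncomp sys \<nu>"
  shows "symbol_1 sys r s (wave sys s \<nu> b) K = (if K \<in> top_idx sys
    then \<Sum>p\<in>UNIV. \<Sum>jj\<in>tuples (sys_order sys - \<nu> - 1). principal_N sys p K (\<nu>, jj, b) * of_real (s $ p) * s_prod s jj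
    else 0)"
proof (cases "K \<in> top_idx sys")
  case True
  have "A_terms sys (\<lambda>_. 0) (plane_grad s (wave sys s \<nu> b)) K
      = (\<Sum>\<kappa><sys_order sys. \<Sum>kk\<in>tuples (sys_order sys - \<kappa>). \<Sum>c<ncomp sys \<kappa>.
          top_coef sys K (\<kappa>, kk, c) * grad (plane_grad s (wave sys s \<nu> b)) \<kappa> c kk)"
    using A_terms_plane_grad[OF True, of "wave sys s \<nu> b" s] wave_in_states[OF \<nu>, of s]
    by (simp add: states_def grad_plane_grad)
  also have "\<dots> = (\<Sum>\<kappa><sys_order sys. if \<kappa> = \<nu> then \<Sum>kk\<in>tuples (sys_order sys - \<kappa>). \<Sum>c<ncomp sys \<kappa>.
          if c = b then top_coef sys K (\<kappa>, kk, c) * s_prod s kk else 0 else 0)"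
  proof (rule sum.cong[OF refl])
    fix \<kappa> assume \<kappa>: "\<kappa> \<in> {..<sys_order sys}"
    have "kk \<noteq> []" if "kk \<in> tuples (sys_order sys - \<kappa>)" for kk
      using that \<kappa> by (auto simp: tuples_def)
    then show "(\<Sum>kk\<in>tuples (sys_order sys - \<kappa>). \<Sum>c<ncomp sys \<kappa>.
          top_coef sys K (\<kappa>, kk, c) * grad (plane_grad s (wave sys s \<nu> b)) \<kappa> c kk)
        = (if \<kappa> = \<nu> then \<Sum>kk\<in>tuples (sys_order sys - \<kappa>). \<Sum>c<ncomp sys \<kappa>.
          if c = b then top_coef sys K (\<kappa>, kk, c) * s_prod s kk else 0 else 0)"
      by (auto simp: grad_wave[OF \<nu>(1)] tuples_def if_distrib[of "\<lambda>x. _ * x"] cong: if_cong intro!: sum.cong sum.neutral simp del: top_coef.simps)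
  qed
  also have "\<dots> = (\<Sum>kk\<in>tuples (sys_order sys - \<nu>). top_coef sys K (\<nu>, kk, b) * s_prod s kk)"
    using \<nu> by (simp del: top_coef.simps)
  also have "\<dots> = (\<Sum>p\<in>UNIV. \<Sum>jj\<in>tuples (sys_order sys - \<nu> - 1). principal_N sys p K (\<nu>, jj, b) * of_real (s $ p) * s_prod s jj)"
    by (rule top_coef_contracted[OF True \<nu>(1)])
  finally show ?thesis
    using True top_subset_red by (auto simp: symbol_1_eq constraint_addition_wave[OF \<nu>(1)])
next
  case False
  then show ?thesis
    using A_terms_lower[of K sys] by (simp add: symbol_1_eq constraint_addition_wave[OF \<nu>(1)])
qed

text \<open>Waves are the columns of \<open>S^N\<close>, so the contracted FTNS matrix consists of
  values of the first order form, whatever the parameters \<open>r\<close>.\<close>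

lemma contracted_N_eq_sesq:
  assumes \<mu>: "\<mu> < sys_order sys" "a < ncomp sys \<mu>" and \<nu>: "\<nu> < sys_order sys" "b < ncomp sys \<nu>"
  shows "contracted_N sys H s (\<mu>, a) (\<nu>, b)
    = sesq (red_idx sys) H (wave sys s \<mu> a) (symbol_1 sys r s (wave sys s \<nu> b))"
proof -
  let ?V = "symbol_1 sys r s (wave sys s \<nu> b)"
  have cnj_wave: "cnj (wave sys s \<mu> a I) = wave sys s \<mu> a I" for I
    by (cases I) (simp add: wave_def s_prod_def)
  have "sesq (red_idx sys) H (wave sys s \<mu> a) ?V = sesq (top_idx sys) H (wave sys s \<mu> a) ?V"
  proof (rule sesq_supported[OF finite_red_idx top_subset_red])
    fix I assume "I \<in> red_idx sys - top_idx sys"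
    then show "wave sys s \<mu> a I = 0"
      using wave_in_states[OF \<mu>, of s] by (simp add: states_def del: split_paired_All)
    show "?V I = 0"
      using \<open>I \<in> red_idx sys - top_idx sys\<close> by (simp add: symbol_1_wave[OF \<nu>])
  qed
  also have "\<dots> = (\<Sum>I\<in>top_idx sys. wave sys s \<mu> a I * (\<Sum>K\<in>top_idx sys. H I K * ?V K))"
    by (simp add: sesq_def cnj_wave sum_distrib_left mult.assoc)
  also have "\<dots> = (\<Sum>ii\<in>tuples (sys_order sys - \<mu> - 1). s_prod s ii * (\<Sum>K\<in>top_idx sys. H (\<mu>, ii, a) K * ?V K))"
    by (rule sum_top_wave[OF \<mu>])
  also have "\<dots> = contracted_N sys H s (\<mu>, a) (\<nu>, b)"
    by (simp add: symbol_1_wave[OF \<nu>] sum_distrib_left mult.assoc cong: sum.cong)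
  finally show ?thesis ..
qed

text \<open>The block of \<open>H\<close> on top-rank labels is the FTNS symmetrizer: Hermiticity of
  the first order form is applied to waves, and definiteness to top-rank states extended by
  zero.\<close>

lemma first_order_imp_ftns:
  assumes "first_order_symmetric_hyperbolic sys"
  shows "ftns_symmetric_hyperbolic sys"
proof -
  obtain H r where H: "symmetric_hermitian (red_idx sys) H" "positive_definite_on (red_idx sys) H"
    and herm: "\<And>s u w. u \<in> states (red_idx sys) \<Longrightarrow> w \<in> states (red_idx sys) \<Longrightarrow>
      sesq (red_idx sys) H u (symbol_1 sys r s w) = cnj (sesq (red_idx sys) H w (symbol_1 sys r s u))"
    using assms unfolding first_order_symmetric_hyperbolic_def first_order_candidate_symmetrizer_def
    by blast
  have "symmetric_hermitian (top_idx sys) H"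
    using H(1) top_subset_red[of sys]
    unfolding symmetric_hermitian_def hermitian_on_def symmetric_on_def by (meson subsetD)
  moreover have "hermitian_on {(\<mu>, a). \<mu> < sys_order sys \<and> a < ncomp sys \<mu>} (contracted_N sys H s)" for s
  proof -
    have "contracted_N sys H s (\<mu>, a) (\<nu>, b) = cnj (contracted_N sys H s (\<nu>, b) (\<mu>, a))"
      if \<mu>: "\<mu> < sys_order sys" "a < ncomp sys \<mu>" and \<nu>: "\<nu> < sys_order sys" "b < ncomp sys \<nu>" for \<mu> a \<nu> b
      unfolding contracted_N_eq_sesq[OF \<mu> \<nu>, where r=r] contracted_N_eq_sesq[OF \<nu> \<mu>, where r=r]
      using wave_in_states[OF \<mu>] wave_in_states[OF \<nu>] states_top_subset_red by (blast intro: herm)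
    then show ?thesis
      unfolding hermitian_on_def by auto
  qed
  moreover have "positive_definite_on (top_idx sys) H"
    unfolding positive_definite_on_def
  proof (intro ballI impI)
    fix u assume u: "u \<in> states (top_idx sys)" "u \<noteq> (\<lambda>_. 0)"
    have "sesq (red_idx sys) H u u = sesq (top_idx sys) H u u"
      by (rule sesq_supported[OF finite_red_idx top_subset_red])
        (use u in \<open>simp_all add: states_def del: split_paired_All\<close>)
    moreover have "u \<in> states (red_idx sys)"
      using u(1) states_top_subset_red by blast
    ultimately show "0 < Re (sesq (top_idx sys) H u u)"
      using H(2) u(2) unfolding positive_definite_on_def by metis
  qed
  ultimately show ?thesis
    unfolding ftns_symmetric_hyperbolic_def ftns_candidate_symmetrizer_def by blast
qed

section \<open>From FTNS to first order symmetrizers\<close>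

text \<open>Coefficients of \<open>H A^p\<close> before constraint additions, with
  \<open>p = hd kk\<close> and column indices \<open>tl kk\<close>.\<close>

definition HA_coef :: "ftns_system \<Rightarrow> (idx \<Rightarrow> idx \<Rightarrow> complex) \<Rightarrow> idx \<Rightarrow> idx \<Rightarrow> complex" where
  "HA_coef sys H I q = (\<Sum>K\<in>top_idx sys. H I K * top_coef sys K q)"

text \<open>Turns the candidate condition into an identity between polynomials in \<open>s\<close>,
  as \<open>tensor_with_symmetrizations\<close> requires.\<close>

lemma contracted_N_eq_HA_coef:
  assumes \<mu>: "\<mu> < sys_order sys" "a < ncomp sys \<mu>" and \<nu>: "\<nu> < sys_order sys" "b < ncomp sys \<nu>"
  shows "contracted_N sys H s (\<mu>, a) (\<nu>, b) = (\<Sum>ii\<in>tuples (sys_order sys - \<mu> - 1).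
    \<Sum>kk\<in>tuples (sys_order sys - \<nu>). s_prod s ii * s_prod s kk * HA_coef sys H (\<mu>, ii, a) (\<nu>, kk, b))"
proof -
  have "contracted_N sys H s (\<mu>, a) (\<nu>, b) = (\<Sum>ii\<in>tuples (sys_order sys - \<mu> - 1). \<Sum>K\<in>top_idx sys.
      s_prod s ii * H (\<mu>, ii, a) K * (\<Sum>p\<in>UNIV. \<Sum>jj\<in>tuples (sys_order sys - \<nu> - 1).
        principal_N sys p K (\<nu>, jj, b) * of_real (s $ p) * s_prod s jj))"
    by (simp add: sum_distrib_left mult.assoc)
  also have "\<dots> = (\<Sum>ii\<in>tuples (sys_order sys - \<mu> - 1). \<Sum>K\<in>top_idx sys.
      s_prod s ii * H (\<mu>, ii, a) K * (\<Sum>kk\<in>tuples (sys_order sys - \<nu>). top_coef sys K (\<nu>, kk, b) * s_prod s kk))"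
    by (intro sum.cong refl) (simp only: top_coef_contracted[OF _ \<nu>(1)])
  also have "\<dots> = (\<Sum>ii\<in>tuples (sys_order sys - \<mu> - 1).
    \<Sum>kk\<in>tuples (sys_order sys - \<nu>). s_prod s ii * s_prod s kk * HA_coef sys H (\<mu>, ii, a) (\<nu>, kk, b))"
    unfolding HA_coef_def sum_distrib_left
    by (rule sum.cong[OF refl], subst sum.swap, intro sum.cong refl)
      (simp only: mult.assoc mult.commute mult.left_commute)
  finally show ?thesis .
qed

lemma HA_coef_cong_class:
  assumes "symmetric_hermitian (top_idx sys) H" "I \<in> top_idx sys" "idx_class I' = idx_class I"
  shows "HA_coef sys H I' q = HA_coef sys H I q"
  unfolding HA_coef_def
  by (intro sum.cong refl) (simp only: symmetric_hermitianD(1)[OF rank_closed_top assms(1,2) _ assms(3)])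

text \<open>\<open>T\<close> is what \<open>H A^p\<close> is to become after the constraint
  additions. It is built block by block with \<open>tensor_with_symmetrizations\<close>, whose
  second condition ensures that averaging with the adjoint preserves the first.\<close>

lemma hermitian_tensor:
  assumes H: "ftns_candidate_symmetrizer sys H"
  obtains T :: "idx \<Rightarrow> 3 \<Rightarrow> idx \<Rightarrow> complex" where
    "\<And>I p J. T I p J = cnj (T J p I)"
    "\<And>I I' p J. I \<in> top_idx sys \<Longrightarrow> J \<in> top_idx sys \<Longrightarrow> idx_class I' = idx_class I \<Longrightarrow> T I' p J = T I p J"
    "\<And>I \<nu> kk b. I \<in> top_idx sys \<Longrightarrow> \<nu> < sys_order sys \<Longrightarrow> b < ncomp sys \<nu> \<Longrightarrow> kk \<in> tuples (sys_order sys - \<nu>) \<Longrightarrow>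
      symmetrize (\<lambda>kk. T I (hd kk) (\<nu>, tl kk, b)) kk = symmetrize (\<lambda>kk. HA_coef sys H I (\<nu>, kk, b)) kk"
proof -
  let ?N = "sys_order sys"
  have sH: "symmetric_hermitian (top_idx sys) H"
    using H by (simp add: ftns_candidate_symmetrizer_def)
  define \<Phi> where "\<Phi> \<mu> a \<nu> b T \<longleftrightarrow>
    (\<forall>ii ii' p jj. mset ii = mset ii' \<longrightarrow> T ii p jj = T ii' p jj) \<and>
    (\<forall>ii p jj jj'. mset jj = mset jj' \<longrightarrow> T ii p jj = T ii p jj') \<and>
    (\<forall>ii\<in>tuples (?N - \<mu> - 1). \<forall>kk\<in>tuples (?N - \<nu>).
      symmetrize (\<lambda>kk. T ii (hd kk) (tl kk)) kk = symmetrize (\<lambda>kk. HA_coef sys H (\<mu>, ii, a) (\<nu>, kk, b)) kk) \<and>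
    (\<forall>kk\<in>tuples (?N - \<mu>). \<forall>jj\<in>tuples (?N - \<nu> - 1).
      symmetrize (\<lambda>kk. T (tl kk) (hd kk) jj) kk = symmetrize (\<lambda>kk. cnj (HA_coef sys H (\<nu>, jj, b) (\<mu>, kk, a))) kk)"
    for \<mu> a \<nu> b and T :: "3 list \<Rightarrow> 3 \<Rightarrow> 3 list \<Rightarrow> complex"
  \<comment> \<open>The range conditions stand inside the existential so that a choice function
    exists for all arguments.\<close>
  have "\<exists>T. \<mu> < ?N \<longrightarrow> a < ncomp sys \<mu> \<longrightarrow> \<nu> < ?N \<longrightarrow> b < ncomp sys \<nu> \<longrightarrow> \<Phi> \<mu> a \<nu> b T" for \<mu> a \<nu> b
  proof (cases "\<mu> < ?N \<and> a < ncomp sys \<mu> \<and> \<nu> < ?N \<and> b < ncomp sys \<nu>")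
    case True
    then have \<mu>: "\<mu> < ?N" "a < ncomp sys \<mu>" and \<nu>: "\<nu> < ?N" "b < ncomp sys \<nu>" by auto
    have N: "Suc (?N - \<mu> - 1) = ?N - \<mu>" "Suc (?N - \<nu> - 1) = ?N - \<nu>"
      using \<mu> \<nu> by auto
    have top: "(\<kappa>, ii, c) \<in> top_idx sys" if "\<kappa> < ?N" "c < ncomp sys \<kappa>" "length ii = ?N - \<kappa> - 1" for \<kappa> ii c
      using that by (simp add: top_idx_def)
    have "contracted_N sys H s (\<mu>, a) (\<nu>, b) = cnj (contracted_N sys H s (\<nu>, b) (\<mu>, a))" for s
      using H \<mu> \<nu> unfolding ftns_candidate_symmetrizer_def hermitian_on_def by blast
    then have compat: "(\<Sum>ii\<in>tuples (?N - \<mu> - 1). \<Sum>kk\<in>tuples (?N - \<nu>).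
          s_prod s ii * s_prod s kk * HA_coef sys H (\<mu>, ii, a) (\<nu>, kk, b))
        = (\<Sum>kk\<in>tuples (?N - \<mu>). \<Sum>jj\<in>tuples (?N - \<nu> - 1).
          s_prod s kk * s_prod s jj * cnj (HA_coef sys H (\<nu>, jj, b) (\<mu>, kk, a)))" for s
      unfolding contracted_N_eq_HA_coef[OF \<mu> \<nu>] contracted_N_eq_HA_coef[OF \<nu> \<mu>]
      by (subst (2) sum.swap) (simp add: s_prod_def mult.commute)
    obtain T where T: "\<And>ii ii' p jj. mset ii = mset ii' \<Longrightarrow> T ii p jj = T ii' p jj"
      "\<And>ii p jj jj'. mset jj = mset jj' \<Longrightarrow> T ii p jj = T ii p jj'"
      "\<And>ii kk. ii \<in> tuples (?N - \<mu> - 1) \<Longrightarrow> kk \<in> tuples (?N - \<nu>) \<Longrightarrow>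
        symmetrize (\<lambda>kk. T ii (hd kk) (tl kk)) kk = symmetrize (\<lambda>kk. HA_coef sys H (\<mu>, ii, a) (\<nu>, kk, b)) kk"
      "\<And>kk jj. kk \<in> tuples (?N - \<mu>) \<Longrightarrow> jj \<in> tuples (?N - \<nu> - 1) \<Longrightarrow>
        symmetrize (\<lambda>kk. T (tl kk) (hd kk) jj) kk = symmetrize (\<lambda>kk. cnj (HA_coef sys H (\<nu>, jj, b) (\<mu>, kk, a))) kk"
    proof (rule tensor_with_symmetrizations[of "?N - \<mu> - 1" "\<lambda>ii kk. HA_coef sys H (\<mu>, ii, a) (\<nu>, kk, b)"
          "?N - \<nu> - 1" "\<lambda>kk jj. cnj (HA_coef sys H (\<nu>, jj, b) (\<mu>, kk, a))", unfolded N])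
      fix ii ii' kk :: "3 list" assume "length ii = ?N - \<mu> - 1" "mset ii = mset ii'"
      then show "HA_coef sys H (\<mu>, ii, a) (\<nu>, kk, b) = HA_coef sys H (\<mu>, ii', a) (\<nu>, kk, b)"
        by (intro HA_coef_cong_class[symmetric] sH top \<mu>) simp_all
    next
      fix kk jj jj' :: "3 list" assume "length jj = ?N - \<nu> - 1" "mset jj = mset jj'"
      then show "cnj (HA_coef sys H (\<nu>, jj, b) (\<mu>, kk, a)) = cnj (HA_coef sys H (\<nu>, jj', b) (\<mu>, kk, a))"
        by (intro arg_cong[where f=cnj] HA_coef_cong_class[symmetric] sH top \<nu>) simp_all
    qed (use compat in blast)+
    then have "\<Phi> \<mu> a \<nu> b T" unfolding \<Phi>_def by blast
    then show ?thesis by blast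
  qed blast
  then obtain T0 where T0: "\<And>\<mu> a \<nu> b. \<mu> < ?N \<Longrightarrow> a < ncomp sys \<mu> \<Longrightarrow> \<nu> < ?N \<Longrightarrow> b < ncomp sys \<nu> \<Longrightarrow> \<Phi> \<mu> a \<nu> b (T0 \<mu> a \<nu> b)"
    by metis
  \<comment> \<open>The blocks were chosen independently. Averaging with the adjoint makes them
    Hermitian, and by the last part of \<Phi> the adjoint has the same symmetrization as the block
    itself.\<close>
  define T where "T I p J = (case I of (\<mu>, ii, a) \<Rightarrow> case J of (\<nu>, jj, b) \<Rightarrow>
    (T0 \<mu> a \<nu> b ii p jj + cnj (T0 \<nu> b \<mu> a jj p ii)) / 2)" for I :: idx and p and J :: idx
  show ?thesis
  proof
    show "T I p J = cnj (T J p I)" for I p J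
      by (cases I; cases J) (simp add: T_def)
  next
    fix I I' p J assume IJ: "I \<in> top_idx sys" "J \<in> top_idx sys" "idx_class I' = idx_class I"
    obtain \<mu> ii a ii' where I: "I = (\<mu>, ii, a)" "I' = (\<mu>, ii', a)" "mset ii' = mset ii" "\<mu> < ?N" "a < ncomp sys \<mu>"
      using IJ by (cases I; cases I') (auto simp: top_idx_def)
    obtain \<nu> jj b where J: "J = (\<nu>, jj, b)" "\<nu> < ?N" "b < ncomp sys \<nu>"
      using IJ by (auto simp: top_idx_def)
    have "T0 \<mu> a \<nu> b ii' p jj = T0 \<mu> a \<nu> b ii p jj"
      using T0[OF I(4,5) J(2,3)] I(3) unfolding \<Phi>_def by blast
    moreover have "T0 \<nu> b \<mu> a jj p ii' = T0 \<nu> b \<mu> a jj p ii"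
      using T0[OF J(2,3) I(4,5)] I(3) unfolding \<Phi>_def by blast
    ultimately show "T I' p J = T I p J"
      by (simp add: T_def I J)
  next
    fix I \<nu> kk b assume I: "I \<in> top_idx sys" and \<nu>: "\<nu> < ?N" "b < ncomp sys \<nu>" and kk: "kk \<in> tuples (?N - \<nu>)"
    obtain \<mu> ii a where I': "I = (\<mu>, ii, a)" "\<mu> < ?N" "a < ncomp sys \<mu>" "ii \<in> tuples (?N - \<mu> - 1)"
      using I by (auto simp: top_idx_def tuples_def)
    have "symmetrize (\<lambda>kk. T I (hd kk) (\<nu>, tl kk, b)) kk
        = symmetrize (\<lambda>kk. 1 / 2 * (T0 \<mu> a \<nu> b ii (hd kk) (tl kk) + cnj (T0 \<nu> b \<mu> a (tl kk) (hd kk) ii))) kk"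
      by (simp add: T_def I')
    also have "\<dots> = 1 / 2 * (symmetrize (\<lambda>kk. T0 \<mu> a \<nu> b ii (hd kk) (tl kk)) kk
        + cnj (symmetrize (\<lambda>kk. T0 \<nu> b \<mu> a (tl kk) (hd kk) ii) kk))"
      by (simp only: symmetrize_mult_left symmetrize_add symmetrize_cnj)
    also have "symmetrize (\<lambda>kk. T0 \<nu> b \<mu> a (tl kk) (hd kk) ii) kk = symmetrize (\<lambda>kk. cnj (HA_coef sys H (\<mu>, ii, a) (\<nu>, kk, b))) kk"
      using T0[OF \<nu> I'(2,3)] kk I'(4) unfolding \<Phi>_def by blast
    also have "symmetrize (\<lambda>kk. T0 \<mu> a \<nu> b ii (hd kk) (tl kk)) kk = symmetrize (\<lambda>kk. HA_coef sys H (\<mu>, ii, a) (\<nu>, kk, b)) kk"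
      using T0[OF I'(2,3) \<nu>] kk I'(4) unfolding \<Phi>_def by blast
    finally show "symmetrize (\<lambda>kk. T I (hd kk) (\<nu>, tl kk, b)) kk = symmetrize (\<lambda>kk. HA_coef sys H I (\<nu>, kk, b)) kk"
      by (simp add: symmetrize_cnj I')
  qed
qed

text \<open>On lower ranks the entries mark equal classes instead of equal labels, as the form must
  be invariant under index permutations. On symmetric states this is the identity up to positive
  weights.\<close>

definition extend_H :: "ftns_system \<Rightarrow> (idx \<Rightarrow> idx \<Rightarrow> complex) \<Rightarrow> idx \<Rightarrow> idx \<Rightarrow> complex" where
  "extend_H sys H I J = (if I \<in> top_idx sys \<and> J \<in> top_idx sys then H I J
    else of_bool (I \<notin> top_idx sys \<and> J \<notin> top_idx sys \<and> idx_class I = idx_class J))"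

lemma sesq_extend_H:
  "sesq (red_idx sys) (extend_H sys H) u w = sesq (top_idx sys) H u w
    + (\<Sum>I\<in>red_idx sys - top_idx sys. \<Sum>J | J \<in> red_idx sys - top_idx sys \<and> idx_class I = idx_class J. cnj (u I) * w J)"
proof -
  let ?L = "red_idx sys - top_idx sys"
  have split: "(\<Sum>I\<in>red_idx sys. f I) = (\<Sum>I\<in>top_idx sys. f I) + (\<Sum>I\<in>?L. f I)" for f :: "idx \<Rightarrow> complex"
    by (simp add: sum.subset_diff[OF top_subset_red])
  have "(\<Sum>I\<in>top_idx sys. \<Sum>J\<in>red_idx sys. cnj (u I) * extend_H sys H I J * w J) = sesq (top_idx sys) H u w"
    by (simp add: split extend_H_def sesq_def)
  moreover have "(\<Sum>I\<in>?L. \<Sum>J\<in>red_idx sys. cnj (u I) * extend_H sys H I J * w J)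
      = (\<Sum>I\<in>?L. \<Sum>J | J \<in> ?L \<and> idx_class I = idx_class J. cnj (u I) * w J)"
  proof (rule sum.cong[OF refl])
    fix I assume "I \<in> ?L"
    then show "(\<Sum>J\<in>red_idx sys. cnj (u I) * extend_H sys H I J * w J)
        = (\<Sum>J | J \<in> ?L \<and> idx_class I = idx_class J. cnj (u I) * w J)"
      unfolding split by (subst sum.inter_filter) (auto simp: extend_H_def intro!: sum.cong)
  qed
  ultimately show ?thesis
    unfolding sesq_def[of "red_idx sys"] split[of "\<lambda>I. \<Sum>J\<in>red_idx sys. cnj (u I) * extend_H sys H I J * w J"] by simp
qed

lemma symmetric_hermitian_extend_H:
  assumes H: "symmetric_hermitian (top_idx sys) H"
  shows "symmetric_hermitian (red_idx sys) (extend_H sys H)"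
proof -
  note Hsym = symmetric_hermitianD[OF rank_closed_top H]
  have top: "J \<in> top_idx sys \<longleftrightarrow> I \<in> top_idx sys" if "idx_class J = idx_class I" for I J
    using rank_closed_idx_class[OF rank_closed_top] that by metis
  have herm: "extend_H sys H I J = cnj (extend_H sys H J I)" for I J
    using Hsym(3)[of I J] by (auto simp: extend_H_def)
  have row: "extend_H sys H I' J = extend_H sys H I J" if "idx_class I' = idx_class I" for I I' J
    using Hsym(1)[of I J I'] top[OF that] that by (simp add: extend_H_def)
  have col: "extend_H sys H I J' = extend_H sys H I J" if "idx_class J' = idx_class J" for I J J'
    using row[OF that, of I] herm by metis
  show ?thesis
    unfolding symmetric_hermitian_def hermitian_on_def symmetric_on_iff[OF rank_closed_red]
    using herm row col by blast
qed

text \<open>The lower ranks contribute squares weighted by class sizes. If the top-rank part of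
  \<open>u\<close> vanishes, some lower entry does not.\<close>

lemma positive_definite_extend_H:
  assumes H: "positive_definite_on (top_idx sys) H"
  shows "positive_definite_on (red_idx sys) (extend_H sys H)"
  unfolding positive_definite_on_def
proof (intro ballI impI)
  fix u assume u: "u \<in> states (red_idx sys)" and u0: "u \<noteq> (\<lambda>_. 0)"
  let ?L = "red_idx sys - top_idx sys"
  define v where "v I = (if I \<in> top_idx sys then u I else 0)" for I
  have usym: "u J = u I" if "I \<in> red_idx sys" "idx_class J = idx_class I" for I J
    using u that unfolding states_def symmetric_on_iff[OF rank_closed_red] by blast
  have v: "v \<in> states (top_idx sys)"
    unfolding states_def mem_Collect_eq symmetric_on_iff[OF rank_closed_top]
  proof (intro conjI ballI allI impI)
    fix I J assume IJ: "I \<in> top_idx sys" "idx_class J = idx_class I"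
    then have "J \<in> top_idx sys" by (rule rank_closed_idx_class[OF rank_closed_top])
    then show "v J = v I"
      using usym[OF _ IJ(2)] IJ(1) top_subset_red by (auto simp: v_def)
  qed (simp add: v_def)
  have "sesq (top_idx sys) H u u = sesq (top_idx sys) H v v"
    by (simp add: sesq_def v_def)
  moreover have vpos: "v \<noteq> (\<lambda>_. 0) \<Longrightarrow> 0 < Re (sesq (top_idx sys) H v v)"
    using H v unfolding positive_definite_on_def by blast
  moreover have "v = (\<lambda>_. 0) \<Longrightarrow> Re (sesq (top_idx sys) H v v) = 0"
    by (simp add: sesq_def)
  ultimately have top: "v \<noteq> (\<lambda>_. 0) \<Longrightarrow> Re (sesq (top_idx sys) H u u) > 0"
    "v = (\<lambda>_. 0) \<Longrightarrow> Re (sesq (top_idx sys) H u u) = 0"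
    by simp_all
  define n where "n I = real (card {J \<in> ?L. idx_class I = idx_class J})" for I
  have "(\<Sum>I\<in>?L. \<Sum>J | J \<in> ?L \<and> idx_class I = idx_class J. cnj (u I) * u J) = (\<Sum>I\<in>?L. of_real (n I * (cmod (u I))\<^sup>2))"
  proof (rule sum.cong[OF refl])
    fix I assume I: "I \<in> ?L"
    have "(\<Sum>J | J \<in> ?L \<and> idx_class I = idx_class J. cnj (u I) * u J)
        = (\<Sum>J | J \<in> ?L \<and> idx_class I = idx_class J. cnj (u I) * u I)"
      using usym I by (intro sum.cong refl arg_cong2[where f="(*)"]) auto
    then show "(\<Sum>J | J \<in> ?L \<and> idx_class I = idx_class J. cnj (u I) * u J) = of_real (n I * (cmod (u I))\<^sup>2)"
      by (simp add: n_def complex_norm_square mult.commute del: of_real_power)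
  qed
  then have eq: "Re (sesq (red_idx sys) (extend_H sys H) u u)
      = Re (sesq (top_idx sys) H u u) + (\<Sum>I\<in>?L. n I * (cmod (u I))\<^sup>2)"
    by (simp add: sesq_extend_H)
  have low: "(\<Sum>I\<in>?L. n I * (cmod (u I))\<^sup>2) \<ge> 0"
    by (intro sum_nonneg) (simp add: n_def)
  show "0 < Re (sesq (red_idx sys) (extend_H sys H) u u)"
  proof (cases "v = (\<lambda>_. 0)")
    case True
    obtain I where I: "u I \<noteq> 0" using u0 by blast
    moreover have "I \<in> red_idx sys"
      using I u unfolding states_def by blast
    ultimately have "I \<in> ?L"
      using fun_cong[OF True, of I] by (auto simp: v_def)
    moreover from this have "{J \<in> ?L. idx_class I = idx_class J} \<noteq> {}" by blast
    then have "n I > 0"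
      by (simp add: n_def card_gt_0_iff)
    ultimately have "(\<Sum>I\<in>?L. n I * (cmod (u I))\<^sup>2) > 0"
      using I by (intro sum_pos2[of _ I]) (auto simp: n_def)
    then show ?thesis using eq top(2)[OF True] by simp
  next
    case False
    then show ?thesis using eq top(1)[OF False] low by simp
  qed
qed

text \<open>Parameters without totally symmetric part do not see the symmetrized gradient subtracted
  in \<open>constr_bar\<close>, so they simply add to the coefficients of the gradients of the
  highest variables.\<close>

lemma constraint_addition_top_rank:
  assumes par: "\<And>q. Dpar r K q = 0"
    and rank: "\<And>\<nu> kk b. length kk \<noteq> sys_order sys - \<nu> \<Longrightarrow> Dbpar r K (\<nu>, kk, b) = 0"
    and mixed: "\<And>\<nu> kk b. \<nu> < sys_order sys \<Longrightarrow> b < ncomp sys \<nu> \<Longrightarrow> kk \<in> tuples (sys_order sys - \<nu>) \<Longrightarrow>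
      symmetrize (\<lambda>kk. Dbpar r K (\<nu>, kk, b)) kk = 0"
  shows "constraint_addition sys r (\<lambda>_. 0) du K = (\<Sum>\<nu><sys_order sys. \<Sum>kk\<in>tuples (sys_order sys - \<nu>).
    \<Sum>b<ncomp sys \<nu>. Dbpar r K (\<nu>, kk, b) * grad du \<nu> b kk)"
proof -
  let ?N = "sys_order sys"
  define e where "e \<nu> = (\<Sum>kk\<in>tuples (?N - \<nu>). \<Sum>b<ncomp sys \<nu>. Dbpar r K (\<nu>, kk, b) * constr_bar du \<nu> kk b)" for \<nu>
  have "constraint_addition sys r (\<lambda>_. 0) du K = (\<Sum>\<nu><?N - 1. e \<nu>)"
    unfolding constraint_addition_def
  proof (rule sum.cong[OF refl])
    fix \<nu> assume \<nu>: "\<nu> \<in> {..<?N - 1}"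
    have "(\<Sum>\<sigma>\<in>{1..?N - \<nu> - 1}.
        (\<Sum>kk\<in>tuples \<sigma>. \<Sum>b<ncomp sys \<nu>. Dpar r K (\<nu>, kk, b) * constr (\<lambda>_. 0) du \<nu> kk b) +
        (\<Sum>kk\<in>tuples (\<sigma> + 1). \<Sum>b<ncomp sys \<nu>. Dbpar r K (\<nu>, kk, b) * constr_bar du \<nu> kk b))
      = (\<Sum>\<sigma>\<in>{1..?N - \<nu> - 1}. if \<sigma> = ?N - \<nu> - 1 then e \<nu> else 0)"
    proof (rule sum.cong[OF refl])
      fix \<sigma> assume "\<sigma> \<in> {1..?N - \<nu> - 1}"
      show "(\<Sum>kk\<in>tuples \<sigma>. \<Sum>b<ncomp sys \<nu>. Dpar r K (\<nu>, kk, b) * constr (\<lambda>_. 0) du \<nu> kk b) +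
          (\<Sum>kk\<in>tuples (\<sigma> + 1). \<Sum>b<ncomp sys \<nu>. Dbpar r K (\<nu>, kk, b) * constr_bar du \<nu> kk b)
        = (if \<sigma> = ?N - \<nu> - 1 then e \<nu> else 0)"
      proof (cases "\<sigma> = ?N - \<nu> - 1")
        case True
        then have "\<sigma> + 1 = ?N - \<nu>" using \<nu> by auto
        then show ?thesis using True by (simp add: par e_def)
      next
        case False
        then have "Dbpar r K (\<nu>, kk, b) = 0" if "kk \<in> tuples (\<sigma> + 1)" for kk b
          using that by (intro rank) (auto simp: tuples_def)
        then show ?thesis using False by (simp add: par)
      qed
    qed
    also have "\<dots> = e \<nu>"
      using \<nu> by auto
    finally show "(\<Sum>\<sigma>\<in>{1..?N - \<nu> - 1}.
        (\<Sum>kk\<in>tuples \<sigma>. \<Sum>b<ncomp sys \<nu>. Dpar r K (\<nu>, kk, b) * constr (\<lambda>_. 0) du \<nu> kk b) +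
        (\<Sum>kk\<in>tuples (\<sigma> + 1). \<Sum>b<ncomp sys \<nu>. Dbpar r K (\<nu>, kk, b) * constr_bar du \<nu> kk b)) = e \<nu>" .
  qed
  \<comment> \<open>There is no constraint for \<open>\<nu> = N - 1\<close>, but its index lists
    have length 1, where \<open>constr_bar\<close> vanishes. Including it matches the range of the
    sum for the \<open>A\<close> terms.\<close>
  also have "\<dots> = (\<Sum>\<nu><?N. e \<nu>)"
  proof (rule sum.mono_neutral_left)
    show "\<forall>\<nu>\<in>{..<?N} - {..<?N - 1}. e \<nu> = 0"
    proof
      fix \<nu> assume "\<nu> \<in> {..<?N} - {..<?N - 1}"
      then have \<nu>: "?N - \<nu> = 1" by auto
      have "constr_bar du \<nu> kk b = 0" if kk: "kk \<in> tuples 1" for kk b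
      proof -
        have "ys = kk" if "mset ys = mset kk" for ys
          using kk that by (cases kk) (auto simp: tuples_def)
        then have "symmetrize (grad du \<nu> b) kk = grad du \<nu> b kk"
          by (intro symmetrize_invariant arg_cong[where f="grad du \<nu> b"])
        then show ?thesis by (simp add: constr_bar_def)
      qed
      then show "e \<nu> = 0"
        unfolding e_def \<nu> by simp
    qed
  qed auto
  also have "\<dots> = (\<Sum>\<nu><?N. \<Sum>kk\<in>tuples (?N - \<nu>). \<Sum>b<ncomp sys \<nu>. Dbpar r K (\<nu>, kk, b) * grad du \<nu> b kk)"
  proof (rule sum.cong[OF refl])
    fix \<nu> assume \<nu>: "\<nu> \<in> {..<?N}"
    have "(\<Sum>kk\<in>tuples (?N - \<nu>). Dbpar r K (\<nu>, kk, b) * constr_bar du \<nu> kk b)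
        = (\<Sum>kk\<in>tuples (?N - \<nu>). Dbpar r K (\<nu>, kk, b) * grad du \<nu> b kk)" if b: "b < ncomp sys \<nu>" for b
    proof -
      have "(\<Sum>kk\<in>tuples (?N - \<nu>). Dbpar r K (\<nu>, kk, b) * symmetrize (grad du \<nu> b) kk)
          = (\<Sum>kk\<in>tuples (?N - \<nu>). symmetrize (\<lambda>kk. Dbpar r K (\<nu>, kk, b)) kk * grad du \<nu> b kk)"
        by (rule sum_symmetrize[symmetric])
      also have "\<dots> = 0"
        using mixed \<nu> b by simp
      finally show ?thesis
        by (simp add: constr_bar_def right_diff_distrib sum_subtractf)
    qed
    then show "e \<nu> = (\<Sum>kk\<in>tuples (?N - \<nu>). \<Sum>b<ncomp sys \<nu>. Dbpar r K (\<nu>, kk, b) * grad du \<nu> b kk)"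
      unfolding e_def sum.swap[of _ "{..<ncomp sys \<nu>}" "tuples (?N - \<nu>)"] by simp
  qed
  finally show ?thesis .
qed

text \<open>With \<open>R\<close> inverse to \<open>H\<close> on symmetric states, the parameters
  \<open>R (T - H A)\<close> turn \<open>H\<close> times the principal part into the Hermitian
  tensor \<open>T\<close>.\<close>

lemma ftns_imp_first_order:
  assumes "ftns_symmetric_hyperbolic sys"
  shows "first_order_symmetric_hyperbolic sys"
proof -
  let ?N = "sys_order sys" and ?top = "top_idx sys" and ?red = "red_idx sys"
  obtain H where cand: "ftns_candidate_symmetrizer sys H" and pos: "positive_definite_on ?top H"
    using assms unfolding ftns_symmetric_hyperbolic_def by blast
  have sH: "symmetric_hermitian ?top H"
    using cand by (simp add: ftns_candidate_symmetrizer_def)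
  obtain T where Therm: "\<And>I p J. T I p J = cnj (T J p I)"
    and Tsym: "\<And>I I' p J. I \<in> ?top \<Longrightarrow> J \<in> ?top \<Longrightarrow> idx_class I' = idx_class I \<Longrightarrow> T I' p J = T I p J"
    and TG: "\<And>I \<nu> kk b. I \<in> ?top \<Longrightarrow> \<nu> < ?N \<Longrightarrow> b < ncomp sys \<nu> \<Longrightarrow> kk \<in> tuples (?N - \<nu>) \<Longrightarrow>
      symmetrize (\<lambda>kk. T I (hd kk) (\<nu>, tl kk, b)) kk = symmetrize (\<lambda>kk. HA_coef sys H I (\<nu>, kk, b)) kk"
    using hermitian_tensor[OF cand] by blast
  \<comment> \<open>Hermiticity carries the symmetry from the left argument to the right
    one.\<close>
  have Tsym': "T I p J' = T I p J" if "I \<in> ?top" "J \<in> ?top" "idx_class J' = idx_class J" for I p J J'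
    using Tsym[OF that(2,1,3), of p] Therm by metis
  obtain R where R: "\<And>J. (\<lambda>K. R K J) \<in> states ?top"
    and HR: "\<And>Z I. symmetric_on ?top Z \<Longrightarrow> I \<in> ?top \<Longrightarrow> (\<Sum>K\<in>?top. H I K * (\<Sum>J\<in>?top. R K J * Z J)) = Z I"
    using positive_definite_inverse[OF finite_top_idx rank_closed_top sH pos] by blast
  \<comment> \<open>The required change of \<open>H A^p\<close>. Its symmetrization over
    \<open>kk\<close> vanishes, since those of \<open>T\<close> and \<open>HA_coef\<close>
    agree.\<close>
  define Z where "Z J q = (case q of (\<nu>, kk, b) \<Rightarrow> T J (hd kk) (\<nu>, tl kk, b) - HA_coef sys H J q)" for J and q :: idx
  \<comment> \<open>\<open>H\<close> is divided out. The default 0 for other lengths of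
    \<open>kk\<close> leaves only the constraints of the highest label \<sigma>.\<close>
  define D where "D K q = (case q of (\<nu>, kk, b) \<Rightarrow>
    if length kk = ?N - \<nu> \<and> \<nu> < ?N \<and> b < ncomp sys \<nu> then \<Sum>J\<in>?top. R K J * Z J q else 0)" for K and q :: idx
  define r where "r = \<lparr>Dpar = \<lambda>_ _. 0, Dbpar = D\<rparr>"
  have DbD: "Dbpar r = D" "\<And>I q. Dpar r I q = 0" by (simp_all add: r_def)
  have R_cong: "R I' J = R I J" if "I \<in> ?red" "idx_class I' = idx_class I" for I I' J
    using R[of J] that states_top_subset_red[of sys]
    unfolding states_def symmetric_on_iff[OF rank_closed_red] by blast
  have D_cong: "D I' q = D I q" if "I \<in> ?red" "idx_class I' = idx_class I" for I I' q
    by (cases q) (simp add: D_def R_cong[OF that])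
  \<comment> \<open>\<open>R\<close> takes values in top-rank states, so lower-rank equations
    receive no additions.\<close>
  have D_out: "D K q = 0" if "K \<notin> ?top" for K q
  proof -
    have "R K J = 0" for J
      using R[of J] that unfolding states_def by blast
    then show ?thesis by (cases q) (simp add: D_def)
  qed
  have Z_mixed: "symmetrize (\<lambda>kk. Z J (\<nu>, kk, b)) kk = 0"
    if "J \<in> ?top" "\<nu> < ?N" "b < ncomp sys \<nu>" "kk \<in> tuples (?N - \<nu>)" for J \<nu> b kk
    using TG[OF that] by (simp add: Z_def symmetrize_diff)
  have D_mixed: "symmetrize (\<lambda>kk. D K (\<nu>, kk, b)) kk = 0" if \<nu>: "\<nu> < ?N" "b < ncomp sys \<nu>" for K \<nu> b kk
  proof (cases "kk \<in> tuples (?N - \<nu>)")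
    case True
    have "symmetrize (\<lambda>kk. D K (\<nu>, kk, b)) kk = symmetrize (\<lambda>kk. \<Sum>J\<in>?top. R K J * Z J (\<nu>, kk, b)) kk"
      using True \<nu> by (intro symmetrize_cong) (auto simp: D_def tuples_def dest: mset_eq_length)
    also have "\<dots> = 0"
      using Z_mixed[OF _ \<nu> True] by (simp add: symmetrize_sum symmetrize_mult_left)
    finally show ?thesis .
  next
    case False
    then have zero: "D K (\<nu>, ys, b) = 0" if "mset ys = mset kk" for ys
      using mset_eq_length[OF that] by (simp add: D_def tuples_def)
    then show ?thesis
      using symmetrize_invariant[of kk "\<lambda>kk. D K (\<nu>, kk, b)"] by simp
  qed
  have D_tail: "D I (\<nu>, k # xs, b) = D I (\<nu>, k # ys, b)" if m: "mset xs = mset ys" for I \<nu> k b xs ys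
  proof (cases "length (k # xs) = ?N - \<nu> \<and> \<nu> < ?N \<and> b < ncomp sys \<nu>")
    case True
    then have top: "(\<nu>, ys, b) \<in> ?top"
      using mset_eq_length[OF m] by (auto simp: top_idx_def)
    have "Z J (\<nu>, k # xs, b) = Z J (\<nu>, k # ys, b)" if J: "J \<in> ?top" for J
    proof -
      have "T J k (\<nu>, xs, b) = T J k (\<nu>, ys, b)"
        by (rule Tsym'[OF J top]) (simp add: m)
      moreover have "HA_coef sys H J (\<nu>, k # xs, b) = HA_coef sys H J (\<nu>, k # ys, b)"
        unfolding HA_coef_def top_coef.simps list.sel by (simp only: symmetrize_cong_mset[OF m])
      ultimately show ?thesis by (simp add: Z_def)
    qed
    then show ?thesis
      using mset_eq_length[OF m] by (simp add: D_def)
  next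
    case False
    then show ?thesis
      using mset_eq_length[OF m] by (auto simp: D_def)
  qed
  have adm: "admissible sys r"
    unfolding admissible_def DbD
  proof (intro allI impI ballI conjI)
    fix \<nu> \<sigma> b and kk :: "3 list"
    assume \<nu>: "\<nu> < ?N - 1" "b < ncomp sys \<nu>"
    show "symmetric_on ?red (\<lambda>I. D I (\<nu>, kk, b))"
      unfolding symmetric_on_iff[OF rank_closed_red] using D_cong by blast
    show "symmetrize (\<lambda>kk'. D I (\<nu>, kk', b)) kk = 0" for I
      using \<nu> by (intro D_mixed) auto
  next
    fix \<nu> \<sigma> b k I
    show "symmetric_tensor \<sigma> (\<lambda>kk. D I (\<nu>, k # kk, b))"
      unfolding symmetric_tensor_iff using D_tail by blast
  qed (simp_all add: symmetric_tensor_iff symmetric_on_iff[OF rank_closed_red])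
  \<comment> \<open>The form depends on \<open>T\<close> alone, so its Hermiticity reduces to that
    of \<open>T\<close>.\<close>
  have form: "sesq ?red (extend_H sys H) u (symbol_1 sys r s w)
      = (\<Sum>I\<in>?top. \<Sum>J\<in>?top. \<Sum>p\<in>UNIV. cnj (u I) * T I p J * of_real (s $ p) * w J)"
    if w: "w \<in> states ?red" for s u w
  proof -
    define g where "g \<nu> kk b = of_real (s $ hd kk) * w (\<nu>, tl kk, b)" for \<nu> b and kk :: "3 list"
    have wtop: "symmetric_on ?top w"
      using w top_subset_red[of sys] unfolding states_def symmetric_on_def by blast
    have low: "symbol_1 sys r s w K = 0" if "K \<in> ?red - ?top" for K
      using that A_terms_lower[of K sys] D_out[of K]
      by (simp add: symbol_1_eq constraint_addition_def DbD)
    have sym: "symbol_1 sys r s w K = (\<Sum>\<nu><?N. \<Sum>kk\<in>tuples (?N - \<nu>). \<Sum>b<ncomp sys \<nu>.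
        (top_coef sys K (\<nu>, kk, b) + D K (\<nu>, kk, b)) * g \<nu> kk b)" if K: "K \<in> ?top" for K
    proof -
      have "constraint_addition sys r (\<lambda>_. 0) (plane_grad s w) K = (\<Sum>\<nu><?N. \<Sum>kk\<in>tuples (?N - \<nu>).
          \<Sum>b<ncomp sys \<nu>. D K (\<nu>, kk, b) * g \<nu> kk b)"
        unfolding g_def grad_plane_grad[symmetric] DbD(1)[symmetric]
        by (rule constraint_addition_top_rank) (simp_all add: DbD D_mixed, simp add: D_def)
      moreover have "K \<in> ?red"
        using K top_subset_red by blast
      ultimately show ?thesis
        using A_terms_plane_grad[OF K wtop, of s]
        by (simp add: symbol_1_eq g_def sum.distrib distrib_right del: top_coef.simps)
    qed
    \<comment> \<open>The symbol vanishes on lower ranks, which removes the lower block of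
      \<open>extend_H\<close>.\<close>
    have "sesq ?red (extend_H sys H) u (symbol_1 sys r s w) = sesq ?top H u (symbol_1 sys r s w)"
      unfolding sesq_extend_H using low by (simp cong: conj_cong)
    also have "\<dots> = (\<Sum>I\<in>?top. cnj (u I) * (\<Sum>K\<in>?top. H I K * symbol_1 sys r s w K))"
      by (simp add: sesq_def sum_distrib_left mult.assoc)
    also have "\<dots> = (\<Sum>I\<in>?top. \<Sum>J\<in>?top. \<Sum>p\<in>UNIV. cnj (u I) * T I p J * of_real (s $ p) * w J)"
    proof (rule sum.cong[OF refl])
      fix I assume I: "I \<in> ?top"
      \<comment> \<open>\<open>H R\<close> fixes \<open>Z\<close>, which is symmetric in its row
        label; \<open>HA_coef\<close> cancels and \<open>T\<close> remains.\<close>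
      have HT: "(\<Sum>K\<in>?top. H I K * (top_coef sys K (\<nu>, kk, b) + D K (\<nu>, kk, b))) = T I (hd kk) (\<nu>, tl kk, b)"
        if \<nu>: "\<nu> < ?N" "b < ncomp sys \<nu>" and kk: "kk \<in> tuples (?N - \<nu>)" for \<nu> kk b
      proof -
        have top: "(\<nu>, tl kk, b) \<in> ?top"
          using \<nu> kk by (auto simp: top_idx_def tuples_def)
        have "symmetric_on ?top (\<lambda>J. Z J (\<nu>, kk, b))"
          unfolding symmetric_on_iff[OF rank_closed_top]
        proof (intro ballI allI impI)
          fix J J' assume J: "J \<in> ?top" "idx_class J' = idx_class J"
          then show "Z J' (\<nu>, kk, b) = Z J (\<nu>, kk, b)"
            by (simp only: Z_def prod.case Tsym[OF J(1) top J(2)] HA_coef_cong_class[OF sH J])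
        qed
        from HR[OF this I] have "(\<Sum>K\<in>?top. H I K * D K (\<nu>, kk, b)) = Z I (\<nu>, kk, b)"
          using \<nu> kk by (simp add: D_def tuples_def)
        then show ?thesis
          by (simp add: distrib_left sum.distrib HA_coef_def Z_def del: top_coef.simps)
      qed
      have "(\<Sum>K\<in>?top. H I K * symbol_1 sys r s w K)
          = (\<Sum>K\<in>?top. \<Sum>\<nu><?N. \<Sum>kk\<in>tuples (?N - \<nu>). \<Sum>b<ncomp sys \<nu>.
              H I K * (top_coef sys K (\<nu>, kk, b) + D K (\<nu>, kk, b)) * g \<nu> kk b)"
        by (simp add: sym sum_distrib_left mult.assoc del: top_coef.simps)
      also have "\<dots> = (\<Sum>\<nu><?N. \<Sum>K\<in>?top. \<Sum>kk\<in>tuples (?N - \<nu>). \<Sum>b<ncomp sys \<nu>.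
              H I K * (top_coef sys K (\<nu>, kk, b) + D K (\<nu>, kk, b)) * g \<nu> kk b)"
        by (rule sum.swap)
      also have "\<dots> = (\<Sum>\<nu><?N. \<Sum>kk\<in>tuples (?N - \<nu>). \<Sum>K\<in>?top. \<Sum>b<ncomp sys \<nu>.
              H I K * (top_coef sys K (\<nu>, kk, b) + D K (\<nu>, kk, b)) * g \<nu> kk b)"
        by (rule sum.cong[OF refl], rule sum.swap)
      also have "\<dots> = (\<Sum>\<nu><?N. \<Sum>kk\<in>tuples (?N - \<nu>). \<Sum>b<ncomp sys \<nu>. \<Sum>K\<in>?top.
              H I K * (top_coef sys K (\<nu>, kk, b) + D K (\<nu>, kk, b)) * g \<nu> kk b)"
        by (rule sum.cong[OF refl], rule sum.cong[OF refl], rule sum.swap)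
      also have "\<dots> = (\<Sum>\<nu><?N. \<Sum>kk\<in>tuples (?N - \<nu>). \<Sum>b<ncomp sys \<nu>. T I (hd kk) (\<nu>, tl kk, b) * g \<nu> kk b)"
        by (intro sum.cong refl) (simp add: HT flip: sum_distrib_right del: top_coef.simps)
      also have "\<dots> = (\<Sum>\<nu><?N. \<Sum>jj\<in>tuples (?N - \<nu> - 1). \<Sum>b<ncomp sys \<nu>. \<Sum>p\<in>UNIV.
              T I p (\<nu>, jj, b) * (of_real (s $ p) * w (\<nu>, jj, b)))"
      proof (rule sum.cong[OF refl])
        fix \<nu> assume "\<nu> \<in> {..<?N}"
        then have "?N - \<nu> = Suc (?N - \<nu> - 1)" by auto
        then have "(\<Sum>kk\<in>tuples (?N - \<nu>). \<Sum>b<ncomp sys \<nu>. T I (hd kk) (\<nu>, tl kk, b) * g \<nu> kk b)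
            = (\<Sum>p\<in>UNIV. \<Sum>jj\<in>tuples (?N - \<nu> - 1). \<Sum>b<ncomp sys \<nu>. T I p (\<nu>, jj, b) * (of_real (s $ p) * w (\<nu>, jj, b)))"
          using sum_tuples_Suc[of "\<lambda>kk. \<Sum>b<ncomp sys \<nu>. T I (hd kk) (\<nu>, tl kk, b) * g \<nu> kk b" "?N - \<nu> - 1"]
          by (simp add: g_def)
        also have "\<dots> = (\<Sum>jj\<in>tuples (?N - \<nu> - 1). \<Sum>p\<in>UNIV. \<Sum>b<ncomp sys \<nu>. T I p (\<nu>, jj, b) * (of_real (s $ p) * w (\<nu>, jj, b)))"
          by (rule sum.swap)
        also have "\<dots> = (\<Sum>jj\<in>tuples (?N - \<nu> - 1). \<Sum>b<ncomp sys \<nu>. \<Sum>p\<in>UNIV. T I p (\<nu>, jj, b) * (of_real (s $ p) * w (\<nu>, jj, b)))"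
          by (rule sum.cong[OF refl], rule sum.swap)
        finally show "(\<Sum>kk\<in>tuples (?N - \<nu>). \<Sum>b<ncomp sys \<nu>. T I (hd kk) (\<nu>, tl kk, b) * g \<nu> kk b)
            = (\<Sum>jj\<in>tuples (?N - \<nu> - 1). \<Sum>b<ncomp sys \<nu>. \<Sum>p\<in>UNIV. T I p (\<nu>, jj, b) * (of_real (s $ p) * w (\<nu>, jj, b)))" .
      qed
      also have "\<dots> = (\<Sum>J\<in>?top. \<Sum>p\<in>UNIV. T I p J * (of_real (s $ p) * w J))"
        by (rule sum_top_idx[symmetric])
      finally show "cnj (u I) * (\<Sum>K\<in>?top. H I K * symbol_1 sys r s w K)
          = (\<Sum>J\<in>?top. \<Sum>p\<in>UNIV. cnj (u I) * T I p J * of_real (s $ p) * w J)"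
        by (simp add: sum_distrib_left mult.assoc)
    qed
    finally show ?thesis .
  qed
  have "sesq ?red (extend_H sys H) u (symbol_1 sys r s w) = cnj (sesq ?red (extend_H sys H) w (symbol_1 sys r s u))"
    if uw: "u \<in> states ?red" "w \<in> states ?red" for s u w
  proof -
    have "cnj (\<Sum>I\<in>?top. \<Sum>J\<in>?top. \<Sum>p\<in>UNIV. cnj (w I) * T I p J * of_real (s $ p) * u J)
        = (\<Sum>I\<in>?top. \<Sum>J\<in>?top. \<Sum>p\<in>UNIV. cnj (u J) * T J p I * of_real (s $ p) * w I)"
      unfolding cnj_sum by (intro sum.cong refl) (subst (2) Therm, simp)
    also have "\<dots> = (\<Sum>I\<in>?top. \<Sum>J\<in>?top. \<Sum>p\<in>UNIV. cnj (u I) * T I p J * of_real (s $ p) * w J)"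
      by (rule sum.swap)
    finally show ?thesis
      using form[OF uw(1)] form[OF uw(2)] by simp
  qed
  with adm have "first_order_candidate_symmetrizer sys (extend_H sys H)"
    using symmetric_hermitian_extend_H[OF sH] unfolding first_order_candidate_symmetrizer_def by blast
  then show ?thesis
    using positive_definite_extend_H[OF pos] unfolding first_order_symmetric_hyperbolic_def by blast
qed

theorem mainTheorem3:
  fixes sys :: ftns_system
  assumes "1 \<le> sys_order sys" and "sys_order sys \<le> 4"
  shows "ftns_symmetric_hyperbolic sys \<longleftrightarrow> first_order_symmetric_hyperbolic sys"
  using ftns_imp_first_order first_order_imp_ftns by blast

end
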